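(* Let $L$ be a Lie algebra over a field $\mathbb{F}$ and let $0\to R\to F\to L\to 0$ be a free presentation of $L$, i.e. an exact sequence of Lie algebras over $\mathbb{F}$ in which $F$ is a free Lie algebra and $R$ is an ideal of $F$. Then $$L\wedge L\;\cong\; F^2/[R,F]$$ as Lie algebras.
   Context: Lie algebras are over a fixed field $\mathbb{F}$, not necessarily finite dimensional. $F^2=[F,F]$ denotes the derived subalgebra of $F$, and $[R,F]$ is the ideal of $F$ spanned by the brackets $[r,f]$ with $r\in R$, $f\in F$. The (nonabelian) tensor square $L\otimes L$ of $L$ is the Lie algebra over $\mathbb{F}$ generated by symbols $l\otimes k$ ($l,k\in L$) subject to the relations, for all $c\in\mathbb{F}$ and $l,l',k,k'\in L$: (i) $c(l\otimes k)=cl\otimes k=l\otimes ck$; (ii) $(l+l')\otimes k=l\otimes k+l'\otimes k$ and $l\otimes(k+k')=l\otimes k+l\otimes k'$; (iii) $[l,l']\otimes k=l\otimes[l',k]-l'\otimes[l,k]$ and $l\otimes[k,k']=[k',l]\otimes k-[k,l]\otimes k'$; (iv) $[\,l\otimes k,\;l'\otimes k'\,]=-[k,l]\otimes[l',k']$. $L\,\square\, L$ is the submodule of $L\otimes L$ generated by all elements $l\otimes l$, $l\in L$ (it is an ideal). The exterior square of $L$ is the quotient $L\wedge L=(L\otimes L)/(L\,\square\, L)$. *)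

theory Defs
  imports "HOL-Algebra.Module" "HOL-Algebra.AbelCoset" "HOL.Hull"
begin

section \<open>Lie algebras over a field\<close>

text \<open>The fields \<open>mult\<close> and \<open>one\<close> that a \<^typ>\<open>('k, 'a) module\<close> record inherits from
  rings play no role, exactly as for modules in the library.\<close>

record ('k, 'a) lie_alg = "('k, 'a) module" +
  lie_bracket :: "['a, 'a] \<Rightarrow> 'a"  (\<open>\<lbrace>_,/ _\<rbrace>\<index>\<close>)

locale lie_algebra = field K + module K L
    for K :: "('k, 'm) ring_scheme" (structure)
    and L :: "('k, 'a, 'n) lie_alg_scheme" (structure) +
  assumes bracket_closed:
      "\<lbrakk> x \<in> carrier L; y \<in> carrier L \<rbrakk> \<Longrightarrow> \<lbrace>x, y\<rbrace>\<^bsub>L\<^esub> \<in> carrier L"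
    and bracket_l_distr:
      "\<lbrakk> x \<in> carrier L; y \<in> carrier L; z \<in> carrier L \<rbrakk> \<Longrightarrow>
        \<lbrace>x \<oplus>\<^bsub>L\<^esub> y, z\<rbrace>\<^bsub>L\<^esub> = \<lbrace>x, z\<rbrace>\<^bsub>L\<^esub> \<oplus>\<^bsub>L\<^esub> \<lbrace>y, z\<rbrace>\<^bsub>L\<^esub>"
    and bracket_r_distr:
      "\<lbrakk> x \<in> carrier L; y \<in> carrier L; z \<in> carrier L \<rbrakk> \<Longrightarrow>
        \<lbrace>x, y \<oplus>\<^bsub>L\<^esub> z\<rbrace>\<^bsub>L\<^esub> = \<lbrace>x, y\<rbrace>\<^bsub>L\<^esub> \<oplus>\<^bsub>L\<^esub> \<lbrace>x, z\<rbrace>\<^bsub>L\<^esub>"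
    and bracket_smult_l:
      "\<lbrakk> c \<in> carrier K; x \<in> carrier L; y \<in> carrier L \<rbrakk> \<Longrightarrow>
        \<lbrace>c \<odot>\<^bsub>L\<^esub> x, y\<rbrace>\<^bsub>L\<^esub> = c \<odot>\<^bsub>L\<^esub> \<lbrace>x, y\<rbrace>\<^bsub>L\<^esub>"
    and bracket_smult_r:
      "\<lbrakk> c \<in> carrier K; x \<in> carrier L; y \<in> carrier L \<rbrakk> \<Longrightarrow>
        \<lbrace>x, c \<odot>\<^bsub>L\<^esub> y\<rbrace>\<^bsub>L\<^esub> = c \<odot>\<^bsub>L\<^esub> \<lbrace>x, y\<rbrace>\<^bsub>L\<^esub>"
    and bracket_alternating:
      "x \<in> carrier L \<Longrightarrow> \<lbrace>x, x\<rbrace>\<^bsub>L\<^esub> = \<zero>\<^bsub>L\<^esub>"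
    and jacobi:
      "\<lbrakk> x \<in> carrier L; y \<in> carrier L; z \<in> carrier L \<rbrakk> \<Longrightarrow>
        \<lbrace>x, \<lbrace>y, z\<rbrace>\<^bsub>L\<^esub>\<rbrace>\<^bsub>L\<^esub> \<oplus>\<^bsub>L\<^esub> \<lbrace>y, \<lbrace>z, x\<rbrace>\<^bsub>L\<^esub>\<rbrace>\<^bsub>L\<^esub> \<oplus>\<^bsub>L\<^esub> \<lbrace>z, \<lbrace>x, y\<rbrace>\<^bsub>L\<^esub>\<rbrace>\<^bsub>L\<^esub> = \<zero>\<^bsub>L\<^esub>"

definition lie_ideal ::
    "('k, 'm) ring_scheme \<Rightarrow> ('k, 'a, 'n) lie_alg_scheme \<Rightarrow> 'a set \<Rightarrow> bool" where
  "lie_ideal K L I \<longleftrightarrow>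
     submodule I K L \<and> (\<forall>x \<in> I. \<forall>y \<in> carrier L. \<lbrace>x, y\<rbrace>\<^bsub>L\<^esub> \<in> I)"

definition lie_hom ::
    "('k, 'm) ring_scheme \<Rightarrow> ('k, 'a, 'n) lie_alg_scheme \<Rightarrow> ('k, 'b, 'p) lie_alg_scheme
      \<Rightarrow> ('a \<Rightarrow> 'b) set" where
  "lie_hom K A B = {h \<in> carrier A \<rightarrow> carrier B.
     (\<forall>x \<in> carrier A. \<forall>y \<in> carrier A. h (x \<oplus>\<^bsub>A\<^esub> y) = h x \<oplus>\<^bsub>B\<^esub> h y) \<and>
     (\<forall>c \<in> carrier K. \<forall>x \<in> carrier A. h (c \<odot>\<^bsub>A\<^esub> x) = c \<odot>\<^bsub>B\<^esub> h x) \<and>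
     (\<forall>x \<in> carrier A. \<forall>y \<in> carrier A. h \<lbrace>x, y\<rbrace>\<^bsub>A\<^esub> = \<lbrace>h x, h y\<rbrace>\<^bsub>B\<^esub>)}"

definition lie_iso ::
    "('k, 'm) ring_scheme \<Rightarrow> ('k, 'a, 'n) lie_alg_scheme \<Rightarrow> ('k, 'b, 'p) lie_alg_scheme
      \<Rightarrow> ('a \<Rightarrow> 'b) set" where
  "lie_iso K A B = {h \<in> lie_hom K A B. bij_betw h (carrier A) (carrier B)}"

definition lie_isomorphic ::
    "('k, 'm) ring_scheme \<Rightarrow> ('k, 'a, 'n) lie_alg_scheme \<Rightarrow> ('k, 'b, 'p) lie_alg_scheme
      \<Rightarrow> bool" where
  "lie_isomorphic K A B \<longleftrightarrow> lie_iso K A B \<noteq> {}"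

text \<open>\<open>[A, B]\<close> is the linear span of the brackets \<open>[a, b]\<close>, not merely the set of these.\<close>

definition lie_commutator ::
    "('k, 'm) ring_scheme \<Rightarrow> ('k, 'a, 'n) lie_alg_scheme \<Rightarrow> 'a set \<Rightarrow> 'a set \<Rightarrow> 'a set" where
  "lie_commutator K L A B =
     (\<lambda>N. submodule N K L) hull {\<lbrace>a, b\<rbrace>\<^bsub>L\<^esub> | a b. a \<in> A \<and> b \<in> B}"

definition derived_subalgebra ::
    "('k, 'm) ring_scheme \<Rightarrow> ('k, 'a, 'n) lie_alg_scheme \<Rightarrow> ('k, 'a, 'n) lie_alg_scheme" where
  "derived_subalgebra K L = L\<lparr>carrier := lie_commutator K L (carrier L) (carrier L)\<rparr>"

text \<open>The quotient of \<open>L\<close> by an ideal \<open>I\<close>. As for quotient rings, the elements are the cosets of \<open>I\<close>;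
  each union below is a union of equal cosets when \<open>I\<close> is an ideal of the Lie algebra \<open>L\<close>.\<close>

definition lie_quotient :: "('k, 'a, 'n) lie_alg_scheme \<Rightarrow> 'a set \<Rightarrow> ('k, 'a set) lie_alg" where
  "lie_quotient L I =
    \<lparr>carrier = a_rcosets\<^bsub>L\<^esub> I, mult = undefined, one = undefined,
     zero = I, add = set_add L,
     smult = (\<lambda>c A. \<Union>a \<in> A. I +>\<^bsub>L\<^esub> (c \<odot>\<^bsub>L\<^esub> a)),
     lie_bracket = (\<lambda>A B. \<Union>a \<in> A. \<Union>b \<in> B. I +>\<^bsub>L\<^esub> \<lbrace>a, b\<rbrace>\<^bsub>L\<^esub>)\<rparr>"


section \<open>Lie algebras given by generators and relations\<close>

datatype ('k, 'x) lie_term =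
    Gen 'x
  | Null
  | Add "('k, 'x) lie_term" "('k, 'x) lie_term"
  | Scale 'k "('k, 'x) lie_term"
  | Br "('k, 'x) lie_term" "('k, 'x) lie_term"

definition Neg :: "('k, 'm) ring_scheme \<Rightarrow> ('k, 'x) lie_term \<Rightarrow> ('k, 'x) lie_term" where
  "Neg K t = Scale (\<ominus>\<^bsub>K\<^esub> \<one>\<^bsub>K\<^esub>) t"

inductive_set lie_terms :: "('k, 'm) ring_scheme \<Rightarrow> 'x set \<Rightarrow> ('k, 'x) lie_term set"
  for K :: "('k, 'm) ring_scheme" and X :: "'x set" where
  Gen: "x \<in> X \<Longrightarrow> Gen x \<in> lie_terms K X"
| Null: "Null \<in> lie_terms K X"
| Add: "\<lbrakk> s \<in> lie_terms K X; t \<in> lie_terms K X \<rbrakk> \<Longrightarrow> Add s t \<in> lie_terms K X"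
| Scale: "\<lbrakk> c \<in> carrier K; t \<in> lie_terms K X \<rbrakk> \<Longrightarrow> Scale c t \<in> lie_terms K X"
| Br: "\<lbrakk> s \<in> lie_terms K X; t \<in> lie_terms K X \<rbrakk> \<Longrightarrow> Br s t \<in> lie_terms K X"

text \<open>The smallest congruence on the terms that contains the Lie algebra axioms over \<open>K\<close> and the
  relations \<open>S\<close>, a pair \<open>(s, t) \<in> S\<close> standing for the relation \<open>s = t\<close>.\<close>

inductive_set lie_cong ::
    "('k, 'm) ring_scheme \<Rightarrow> 'x set \<Rightarrow> (('k, 'x) lie_term \<times> ('k, 'x) lie_term) set
      \<Rightarrow> (('k, 'x) lie_term \<times> ('k, 'x) lie_term) set"
  for K :: "('k, 'm) ring_scheme" and X :: "'x set"
    and S :: "(('k, 'x) lie_term \<times> ('k, 'x) lie_term) set" where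
  rel: "\<lbrakk> (s, t) \<in> S; s \<in> lie_terms K X; t \<in> lie_terms K X \<rbrakk> \<Longrightarrow> (s, t) \<in> lie_cong K X S"
| refl: "t \<in> lie_terms K X \<Longrightarrow> (t, t) \<in> lie_cong K X S"
| sym: "(s, t) \<in> lie_cong K X S \<Longrightarrow> (t, s) \<in> lie_cong K X S"
| trans: "\<lbrakk> (s, t) \<in> lie_cong K X S; (t, u) \<in> lie_cong K X S \<rbrakk> \<Longrightarrow> (s, u) \<in> lie_cong K X S"
| cong_Add: "\<lbrakk> (s, s') \<in> lie_cong K X S; (t, t') \<in> lie_cong K X S \<rbrakk> \<Longrightarrow>
    (Add s t, Add s' t') \<in> lie_cong K X S"
| cong_Scale: "\<lbrakk> c \<in> carrier K; (t, t') \<in> lie_cong K X S \<rbrakk> \<Longrightarrow>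
    (Scale c t, Scale c t') \<in> lie_cong K X S"
| cong_Br: "\<lbrakk> (s, s') \<in> lie_cong K X S; (t, t') \<in> lie_cong K X S \<rbrakk> \<Longrightarrow>
    (Br s t, Br s' t') \<in> lie_cong K X S"
| add_assoc: "\<lbrakk> s \<in> lie_terms K X; t \<in> lie_terms K X; u \<in> lie_terms K X \<rbrakk> \<Longrightarrow>
    (Add (Add s t) u, Add s (Add t u)) \<in> lie_cong K X S"
| add_comm: "\<lbrakk> s \<in> lie_terms K X; t \<in> lie_terms K X \<rbrakk> \<Longrightarrow>
    (Add s t, Add t s) \<in> lie_cong K X S"
| add_null: "t \<in> lie_terms K X \<Longrightarrow> (Add Null t, t) \<in> lie_cong K X S"
| add_neg: "t \<in> lie_terms K X \<Longrightarrow> (Add (Neg K t) t, Null) \<in> lie_cong K X S"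
| scale_l_distr: "\<lbrakk> c \<in> carrier K; d \<in> carrier K; t \<in> lie_terms K X \<rbrakk> \<Longrightarrow>
    (Scale (c \<oplus>\<^bsub>K\<^esub> d) t, Add (Scale c t) (Scale d t)) \<in> lie_cong K X S"
| scale_r_distr: "\<lbrakk> c \<in> carrier K; s \<in> lie_terms K X; t \<in> lie_terms K X \<rbrakk> \<Longrightarrow>
    (Scale c (Add s t), Add (Scale c s) (Scale c t)) \<in> lie_cong K X S"
| scale_assoc: "\<lbrakk> c \<in> carrier K; d \<in> carrier K; t \<in> lie_terms K X \<rbrakk> \<Longrightarrow>
    (Scale (c \<otimes>\<^bsub>K\<^esub> d) t, Scale c (Scale d t)) \<in> lie_cong K X S"
| scale_one: "t \<in> lie_terms K X \<Longrightarrow> (Scale \<one>\<^bsub>K\<^esub> t, t) \<in> lie_cong K X S"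
| br_l_distr: "\<lbrakk> s \<in> lie_terms K X; t \<in> lie_terms K X; u \<in> lie_terms K X \<rbrakk> \<Longrightarrow>
    (Br (Add s t) u, Add (Br s u) (Br t u)) \<in> lie_cong K X S"
| br_r_distr: "\<lbrakk> s \<in> lie_terms K X; t \<in> lie_terms K X; u \<in> lie_terms K X \<rbrakk> \<Longrightarrow>
    (Br s (Add t u), Add (Br s t) (Br s u)) \<in> lie_cong K X S"
| br_scale_l: "\<lbrakk> c \<in> carrier K; s \<in> lie_terms K X; t \<in> lie_terms K X \<rbrakk> \<Longrightarrow>
    (Br (Scale c s) t, Scale c (Br s t)) \<in> lie_cong K X S"
| br_scale_r: "\<lbrakk> c \<in> carrier K; s \<in> lie_terms K X; t \<in> lie_terms K X \<rbrakk> \<Longrightarrow>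
    (Br s (Scale c t), Scale c (Br s t)) \<in> lie_cong K X S"
| br_alternating: "t \<in> lie_terms K X \<Longrightarrow> (Br t t, Null) \<in> lie_cong K X S"
| br_jacobi: "\<lbrakk> s \<in> lie_terms K X; t \<in> lie_terms K X; u \<in> lie_terms K X \<rbrakk> \<Longrightarrow>
    (Add (Add (Br s (Br t u)) (Br t (Br u s))) (Br u (Br s t)), Null) \<in> lie_cong K X S"

definition lie_presented ::
    "('k, 'm) ring_scheme \<Rightarrow> 'x set \<Rightarrow> (('k, 'x) lie_term \<times> ('k, 'x) lie_term) set
      \<Rightarrow> ('k, ('k, 'x) lie_term set) lie_alg" where
  "lie_presented K X S =
    \<lparr>carrier = lie_terms K X // lie_cong K X S, mult = undefined, one = undefined,
     zero = lie_cong K X S `` {Null},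
     add = (\<lambda>A B. \<Union>s \<in> A. \<Union>t \<in> B. lie_cong K X S `` {Add s t}),
     smult = (\<lambda>c A. \<Union>t \<in> A. lie_cong K X S `` {Scale c t}),
     lie_bracket = (\<lambda>A B. \<Union>s \<in> A. \<Union>t \<in> B. lie_cong K X S `` {Br s t})\<rparr>"


section \<open>Free Lie algebras and free presentations\<close>

definition free_lie_algebra ::
    "('k, 'm) ring_scheme \<Rightarrow> 'x set \<Rightarrow> ('k, ('k, 'x) lie_term set) lie_alg" where
  "free_lie_algebra K X = lie_presented K X {}"

text \<open>\<open>F\<close> is free on \<open>X \<subseteq> F\<close> if the free Lie algebra on the set \<open>X\<close> is isomorphic to \<open>F\<close> by an
  isomorphism fixing the generators. Taking \<open>X\<close> inside \<open>F\<close> loses no generality: the images of the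
  free generators under any isomorphism from a free Lie algebra onto \<open>F\<close> form such a set.\<close>

definition free_lie_on ::
    "('k, 'm) ring_scheme \<Rightarrow> ('k, 'f, 'n) lie_alg_scheme \<Rightarrow> 'f set \<Rightarrow> bool" where
  "free_lie_on K F X \<longleftrightarrow> X \<subseteq> carrier F \<and>
     (\<exists>\<phi> \<in> lie_iso K (free_lie_algebra K X) F. \<forall>x \<in> X. \<phi> (lie_cong K X {} `` {Gen x}) = x)"

definition is_free_lie :: "('k, 'm) ring_scheme \<Rightarrow> ('k, 'f, 'n) lie_alg_scheme \<Rightarrow> bool" where
  "is_free_lie K F \<longleftrightarrow> lie_algebra K F \<and> (\<exists>X. free_lie_on K F X)"

text \<open>Exactness of \<open>0 \<rightarrow> R \<rightarrow> F \<rightarrow> L \<rightarrow> 0\<close>, where \<open>R \<rightarrow> F\<close> is the inclusion of the ideal \<open>R\<close> and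
  \<open>p\<close> is the map \<open>F \<rightarrow> L\<close>.\<close>

definition free_presentation ::
    "('k, 'm) ring_scheme \<Rightarrow> 'f set \<Rightarrow> ('k, 'f, 'n) lie_alg_scheme
      \<Rightarrow> ('k, 'l, 'q) lie_alg_scheme \<Rightarrow> ('f \<Rightarrow> 'l) \<Rightarrow> bool" where
  "free_presentation K R F L p \<longleftrightarrow>
     is_free_lie K F \<and> lie_ideal K F R \<and>
     p \<in> lie_hom K F L \<and> R = a_kernel F L p \<and> p ` carrier F = carrier L"


section \<open>The nonabelian tensor square and the exterior square\<close>

text \<open>The symbol \<open>l \<otimes> k\<close> is represented by the generator \<open>Gen (l, k)\<close>.\<close>

inductive_set tensor_rels ::
    "('k, 'm) ring_scheme \<Rightarrow> ('k, 'l, 'q) lie_alg_scheme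
      \<Rightarrow> (('k, 'l \<times> 'l) lie_term \<times> ('k, 'l \<times> 'l) lie_term) set"
  for K :: "('k, 'm) ring_scheme" and L :: "('k, 'l, 'q) lie_alg_scheme" where
  scale_l: "\<lbrakk> c \<in> carrier K; l \<in> carrier L; k \<in> carrier L \<rbrakk> \<Longrightarrow>
    (Scale c (Gen (l, k)), Gen (c \<odot>\<^bsub>L\<^esub> l, k)) \<in> tensor_rels K L"
| scale_r: "\<lbrakk> c \<in> carrier K; l \<in> carrier L; k \<in> carrier L \<rbrakk> \<Longrightarrow>
    (Scale c (Gen (l, k)), Gen (l, c \<odot>\<^bsub>L\<^esub> k)) \<in> tensor_rels K L"
| add_l: "\<lbrakk> l \<in> carrier L; l' \<in> carrier L; k \<in> carrier L \<rbrakk> \<Longrightarrow>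
    (Gen (l \<oplus>\<^bsub>L\<^esub> l', k), Add (Gen (l, k)) (Gen (l', k))) \<in> tensor_rels K L"
| add_r: "\<lbrakk> l \<in> carrier L; k \<in> carrier L; k' \<in> carrier L \<rbrakk> \<Longrightarrow>
    (Gen (l, k \<oplus>\<^bsub>L\<^esub> k'), Add (Gen (l, k)) (Gen (l, k'))) \<in> tensor_rels K L"
| bracket_l: "\<lbrakk> l \<in> carrier L; l' \<in> carrier L; k \<in> carrier L \<rbrakk> \<Longrightarrow>
    (Gen (\<lbrace>l, l'\<rbrace>\<^bsub>L\<^esub>, k), Add (Gen (l, \<lbrace>l', k\<rbrace>\<^bsub>L\<^esub>)) (Neg K (Gen (l', \<lbrace>l, k\<rbrace>\<^bsub>L\<^esub>))))
      \<in> tensor_rels K L"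
| bracket_r: "\<lbrakk> l \<in> carrier L; k \<in> carrier L; k' \<in> carrier L \<rbrakk> \<Longrightarrow>
    (Gen (l, \<lbrace>k, k'\<rbrace>\<^bsub>L\<^esub>), Add (Gen (\<lbrace>k', l\<rbrace>\<^bsub>L\<^esub>, k)) (Neg K (Gen (\<lbrace>k, l\<rbrace>\<^bsub>L\<^esub>, k'))))
      \<in> tensor_rels K L"
| bracket: "\<lbrakk> l \<in> carrier L; k \<in> carrier L; l' \<in> carrier L; k' \<in> carrier L \<rbrakk> \<Longrightarrow>
    (Br (Gen (l, k)) (Gen (l', k')), Neg K (Gen (\<lbrace>k, l\<rbrace>\<^bsub>L\<^esub>, \<lbrace>l', k'\<rbrace>\<^bsub>L\<^esub>))) \<in> tensor_rels K L"

definition tensor_square ::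
    "('k, 'm) ring_scheme \<Rightarrow> ('k, 'l, 'q) lie_alg_scheme
      \<Rightarrow> ('k, ('k, 'l \<times> 'l) lie_term set) lie_alg" where
  "tensor_square K L = lie_presented K (carrier L \<times> carrier L) (tensor_rels K L)"

definition tensor ::
    "('k, 'm) ring_scheme \<Rightarrow> ('k, 'l, 'q) lie_alg_scheme \<Rightarrow> 'l \<Rightarrow> 'l
      \<Rightarrow> ('k, 'l \<times> 'l) lie_term set" where
  "tensor K L l k = lie_cong K (carrier L \<times> carrier L) (tensor_rels K L) `` {Gen (l, k)}"

text \<open>The submodule \<open>L \<square> L\<close>.\<close>

definition box_square ::
    "('k, 'm) ring_scheme \<Rightarrow> ('k, 'l, 'q) lie_alg_scheme
      \<Rightarrow> ('k, 'l \<times> 'l) lie_term set set" where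
  "box_square K L =
     (\<lambda>N. submodule N K (tensor_square K L)) hull {tensor K L l l | l. l \<in> carrier L}"

definition exterior_square ::
    "('k, 'm) ring_scheme \<Rightarrow> ('k, 'l, 'q) lie_alg_scheme
      \<Rightarrow> ('k, ('k, 'l \<times> 'l) lie_term set set) lie_alg" where
  "exterior_square K L = lie_quotient (tensor_square K L) (box_square K L)"

end

theory Submission
  imports Defs
begin

text \<open>The map \<open>l \<and> k \<mapsto> [x, y] + [R, F]\<close>, where \<open>x\<close> and \<open>y\<close> are any preimages of \<open>l\<close> and \<open>k\<close>, is a
  homomorphism \<open>L \<and> L \<rightarrow> F\<^sup>2/[R, F]\<close>. For its inverse, relation (iii) says that
  \<open>(l, k) \<mapsto> l \<and> k\<close> is a 2-cocycle of \<open>L\<close> with values in the trivial module \<open>L \<and> L\<close>. The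
  corresponding central extension receives a homomorphism from \<open>F\<close> that lifts \<open>F \<rightarrow> L\<close>, because \<open>F\<close>
  is free. Its second component is a linear map \<open>D : F \<rightarrow> L \<and> L\<close> with \<open>D [x, y] = p x \<and> p y\<close>; it
  vanishes on \<open>[R, F]\<close> and inverts the first map on \<open>F\<^sup>2\<close>.\<close>

section \<open>Lie algebras and homomorphisms\<close>

text \<open>The rule [x, y] \<mapsto> p x \<and> p y does not visibly define a map on F^2, because
  an element of F^2 has many expressions as a combination of brackets. Freeness settles this: a
  homomorphism from F into the extension exists for any prescribed values on the generators, so D is
  obtained on all of F at once, and the rule for brackets is read off from the bracket of the
  extension. There L \<and> L enters only as a vector space; hence D is linear but in general no
  homomorphism on F, and no more is asked of it. Let h be the map from L \<and> L and q the
  projection of F^2 modulo [R, F]. On F^2, D is onto L \<and> L, factors through q and satisfies h D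
  = q, which makes the homomorphism h bijective. Relation (iv) has a different task from (iii): it
  makes the tensor square the linear span of its symbols, so that linear statements can be checked
  on symbols alone.\<close>

lemma lie_algebraI:
  fixes K :: "('k, 'm) ring_scheme" (structure)
    and L :: "('k, 'a, 'n) lie_alg_scheme" (structure)
  assumes "field K"
    and zero: "\<zero>\<^bsub>L\<^esub> \<in> carrier L"
    and add: "\<And>x y. x \<in> carrier L \<Longrightarrow> y \<in> carrier L \<Longrightarrow> x \<oplus>\<^bsub>L\<^esub> y \<in> carrier L"
    and smult: "\<And>c x. c \<in> carrier K \<Longrightarrow> x \<in> carrier L \<Longrightarrow> c \<odot>\<^bsub>L\<^esub> x \<in> carrier L"
    and bracket: "\<And>x y. x \<in> carrier L \<Longrightarrow> y \<in> carrier L \<Longrightarrow> \<lbrace>x, y\<rbrace>\<^bsub>L\<^esub> \<in> carrier L"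
    and assoc: "\<And>x y z. x \<in> carrier L \<Longrightarrow> y \<in> carrier L \<Longrightarrow> z \<in> carrier L \<Longrightarrow>
      (x \<oplus>\<^bsub>L\<^esub> y) \<oplus>\<^bsub>L\<^esub> z = x \<oplus>\<^bsub>L\<^esub> (y \<oplus>\<^bsub>L\<^esub> z)"
    and comm: "\<And>x y. x \<in> carrier L \<Longrightarrow> y \<in> carrier L \<Longrightarrow> x \<oplus>\<^bsub>L\<^esub> y = y \<oplus>\<^bsub>L\<^esub> x"
    and l_zero: "\<And>x. x \<in> carrier L \<Longrightarrow> \<zero>\<^bsub>L\<^esub> \<oplus>\<^bsub>L\<^esub> x = x"
    and l_neg: "\<And>x. x \<in> carrier L \<Longrightarrow> ((\<ominus> \<one>) \<odot>\<^bsub>L\<^esub> x) \<oplus>\<^bsub>L\<^esub> x = \<zero>\<^bsub>L\<^esub>"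
    and smult_l_distr: "\<And>c d x. c \<in> carrier K \<Longrightarrow> d \<in> carrier K \<Longrightarrow> x \<in> carrier L \<Longrightarrow>
      (c \<oplus> d) \<odot>\<^bsub>L\<^esub> x = (c \<odot>\<^bsub>L\<^esub> x) \<oplus>\<^bsub>L\<^esub> (d \<odot>\<^bsub>L\<^esub> x)"
    and smult_r_distr: "\<And>c x y. c \<in> carrier K \<Longrightarrow> x \<in> carrier L \<Longrightarrow> y \<in> carrier L \<Longrightarrow>
      c \<odot>\<^bsub>L\<^esub> (x \<oplus>\<^bsub>L\<^esub> y) = (c \<odot>\<^bsub>L\<^esub> x) \<oplus>\<^bsub>L\<^esub> (c \<odot>\<^bsub>L\<^esub> y)"
    and smult_assoc: "\<And>c d x. c \<in> carrier K \<Longrightarrow> d \<in> carrier K \<Longrightarrow> x \<in> carrier L \<Longrightarrow>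
      (c \<otimes> d) \<odot>\<^bsub>L\<^esub> x = c \<odot>\<^bsub>L\<^esub> (d \<odot>\<^bsub>L\<^esub> x)"
    and smult_one: "\<And>x. x \<in> carrier L \<Longrightarrow> \<one> \<odot>\<^bsub>L\<^esub> x = x"
    and bracket_l_distr: "\<And>x y z. x \<in> carrier L \<Longrightarrow> y \<in> carrier L \<Longrightarrow> z \<in> carrier L \<Longrightarrow>
      \<lbrace>x \<oplus>\<^bsub>L\<^esub> y, z\<rbrace>\<^bsub>L\<^esub> = \<lbrace>x, z\<rbrace>\<^bsub>L\<^esub> \<oplus>\<^bsub>L\<^esub> \<lbrace>y, z\<rbrace>\<^bsub>L\<^esub>"
    and bracket_r_distr: "\<And>x y z. x \<in> carrier L \<Longrightarrow> y \<in> carrier L \<Longrightarrow> z \<in> carrier L \<Longrightarrow>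
      \<lbrace>x, y \<oplus>\<^bsub>L\<^esub> z\<rbrace>\<^bsub>L\<^esub> = \<lbrace>x, y\<rbrace>\<^bsub>L\<^esub> \<oplus>\<^bsub>L\<^esub> \<lbrace>x, z\<rbrace>\<^bsub>L\<^esub>"
    and bracket_smult_l: "\<And>c x y. c \<in> carrier K \<Longrightarrow> x \<in> carrier L \<Longrightarrow> y \<in> carrier L \<Longrightarrow>
      \<lbrace>c \<odot>\<^bsub>L\<^esub> x, y\<rbrace>\<^bsub>L\<^esub> = c \<odot>\<^bsub>L\<^esub> \<lbrace>x, y\<rbrace>\<^bsub>L\<^esub>"
    and bracket_smult_r: "\<And>c x y. c \<in> carrier K \<Longrightarrow> x \<in> carrier L \<Longrightarrow> y \<in> carrier L \<Longrightarrow>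
      \<lbrace>x, c \<odot>\<^bsub>L\<^esub> y\<rbrace>\<^bsub>L\<^esub> = c \<odot>\<^bsub>L\<^esub> \<lbrace>x, y\<rbrace>\<^bsub>L\<^esub>"
    and bracket_alternating: "\<And>x. x \<in> carrier L \<Longrightarrow> \<lbrace>x, x\<rbrace>\<^bsub>L\<^esub> = \<zero>\<^bsub>L\<^esub>"
    and jacobi: "\<And>x y z. x \<in> carrier L \<Longrightarrow> y \<in> carrier L \<Longrightarrow> z \<in> carrier L \<Longrightarrow>
      \<lbrace>x, \<lbrace>y, z\<rbrace>\<^bsub>L\<^esub>\<rbrace>\<^bsub>L\<^esub> \<oplus>\<^bsub>L\<^esub> \<lbrace>y, \<lbrace>z, x\<rbrace>\<^bsub>L\<^esub>\<rbrace>\<^bsub>L\<^esub> \<oplus>\<^bsub>L\<^esub> \<lbrace>z, \<lbrace>x, y\<rbrace>\<^bsub>L\<^esub>\<rbrace>\<^bsub>L\<^esub> = \<zero>\<^bsub>L\<^esub>"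
  shows "lie_algebra K L"
proof -
  interpret K: field K by fact
  have "abelian_group L"
  proof (rule abelian_groupI)
    fix x assume x: "x \<in> carrier L"
    \<comment> \<open>The inverse is given explicitly as the multiple by -1, the same form in which
      the rule \<open>add_neg\<close> of the term congruence provides it.\<close>
    then have "(\<ominus> \<one>) \<odot>\<^bsub>L\<^esub> x \<in> carrier L"
      by (intro smult) auto
    then show "\<exists>y\<in>carrier L. y \<oplus>\<^bsub>L\<^esub> x = \<zero>\<^bsub>L\<^esub>"
      using l_neg[OF x] by blast
  qed fact+
  have "cring K" by (rule K.is_cring)
  have "module K L"
    by (rule moduleI) fact+
  show ?thesis
    by (intro lie_algebra.intro lie_algebra_axioms.intro) fact+
qed

section \<open>Spans and elementary bracket identities\<close>

context lie_algebra
begin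

lemma minus_conv_smult: "x \<in> carrier L \<Longrightarrow> (\<ominus> \<one>) \<odot>\<^bsub>L\<^esub> x = \<ominus>\<^bsub>L\<^esub> x"
  by (simp add: smult_l_minus)

text \<open>Negatives need no clause of their own, being multiples by -1; zero is listed to exclude
  the empty set.\<close>

lemma submodule_iff:
  "submodule N K L \<longleftrightarrow> N \<subseteq> carrier L \<and> \<zero>\<^bsub>L\<^esub> \<in> N \<and> (\<forall>x\<in>N. \<forall>y\<in>N. x \<oplus>\<^bsub>L\<^esub> y \<in> N) \<and>
     (\<forall>c\<in>carrier K. \<forall>x\<in>N. c \<odot>\<^bsub>L\<^esub> x \<in> N)"
  (is "_ \<longleftrightarrow> ?R")
proof
  assume N: "submodule N K L"
  then interpret subgroup N "add_monoid L" by (simp add: submodule_def)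
  show ?R using submoduleE[OF N] one_closed by auto
next
  assume R: ?R
  have "\<ominus>\<^bsub>L\<^esub> x \<in> N" if "x \<in> N" for x
  proof -
    have "(\<ominus> \<one>) \<odot>\<^bsub>L\<^esub> x \<in> N" using R that by simp
    then show ?thesis using R that by (subst minus_conv_smult[symmetric]) auto
  qed
  with R show "submodule N K L" by (intro submoduleI) simp_all
qed

lemma submodule_hull:
  assumes "A \<subseteq> carrier L"
  shows "submodule ((\<lambda>N. submodule N K L) hull A) K L"
proof -
  let ?T = "{N. submodule N K L \<and> A \<subseteq> N}"
  \<comment> \<open>The family has a member inside the carrier; the intersection of an empty family
    would be the whole type.\<close>
  have "carrier L \<in> ?T" using carrier_is_submodule assms by simp
  then have "\<Inter>?T \<subseteq> carrier L" by blast
  moreover have "\<zero>\<^bsub>L\<^esub> \<in> \<Inter>?T" by (auto simp: submodule_iff)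
  moreover have "x \<oplus>\<^bsub>L\<^esub> y \<in> \<Inter>?T" if "x \<in> \<Inter>?T" "y \<in> \<Inter>?T" for x y
    using that by (auto simp: submodule_iff)
  moreover have "c \<odot>\<^bsub>L\<^esub> x \<in> \<Inter>?T" if "c \<in> carrier K" "x \<in> \<Inter>?T" for c x
    using that by (auto simp: submodule_iff)
  ultimately show ?thesis unfolding hull_def submodule_iff[of "\<Inter>?T"] by (intro conjI ballI)
qed

lemma hull_subset_carrier:
  "A \<subseteq> carrier L \<Longrightarrow> (\<lambda>N. submodule N K L) hull A \<subseteq> carrier L"
  by (rule submoduleE(1)[OF submodule_hull])

text \<open>Induction over a linear span: the elements of the carrier with property \<open>P\<close>
  form a submodule containing \<open>A\<close>. Linear or bilinear facts about spans such as [R, F]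
  or the box square are thereby reduced to their generators.\<close>

lemma submodule_hull_induct [consumes 2, case_names generator zero add smult]:
  assumes x: "x \<in> (\<lambda>N. submodule N K L) hull A" and A: "A \<subseteq> carrier L"
    and "\<And>x. x \<in> A \<Longrightarrow> P x" "P \<zero>\<^bsub>L\<^esub>"
    and "\<And>x y. x \<in> carrier L \<Longrightarrow> y \<in> carrier L \<Longrightarrow> P x \<Longrightarrow> P y \<Longrightarrow> P (x \<oplus>\<^bsub>L\<^esub> y)"
    and "\<And>c x. c \<in> carrier K \<Longrightarrow> x \<in> carrier L \<Longrightarrow> P x \<Longrightarrow> P (c \<odot>\<^bsub>L\<^esub> x)"
  shows "P x"
proof -
  have "submodule {x \<in> carrier L. P x} K L"
    using assms(4-) by (auto simp: submodule_iff)
  then have "(\<lambda>N. submodule N K L) hull A \<subseteq> {x \<in> carrier L. P x}"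
    using A assms(3) by (intro hull_minimal) auto
  with x show ?thesis by blast
qed

lemma bracket_zero_l: "x \<in> carrier L \<Longrightarrow> \<lbrace>\<zero>\<^bsub>L\<^esub>, x\<rbrace>\<^bsub>L\<^esub> = \<zero>\<^bsub>L\<^esub>"
  using bracket_smult_l[of "\<zero>" "\<zero>\<^bsub>L\<^esub>" x] by (simp add: bracket_closed)

lemma bracket_zero_r: "x \<in> carrier L \<Longrightarrow> \<lbrace>x, \<zero>\<^bsub>L\<^esub>\<rbrace>\<^bsub>L\<^esub> = \<zero>\<^bsub>L\<^esub>"
  using bracket_smult_r[of "\<zero>" x "\<zero>\<^bsub>L\<^esub>"] by (simp add: bracket_closed)

lemma bracket_minus_l:
  "x \<in> carrier L \<Longrightarrow> y \<in> carrier L \<Longrightarrow> \<lbrace>\<ominus>\<^bsub>L\<^esub> x, y\<rbrace>\<^bsub>L\<^esub> = \<ominus>\<^bsub>L\<^esub> \<lbrace>x, y\<rbrace>\<^bsub>L\<^esub>"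
  using bracket_smult_l[of "\<ominus> \<one>" x y] by (simp add: bracket_closed minus_conv_smult)

lemma bracket_minus_r:
  "x \<in> carrier L \<Longrightarrow> y \<in> carrier L \<Longrightarrow> \<lbrace>x, \<ominus>\<^bsub>L\<^esub> y\<rbrace>\<^bsub>L\<^esub> = \<ominus>\<^bsub>L\<^esub> \<lbrace>x, y\<rbrace>\<^bsub>L\<^esub>"
  using bracket_smult_r[of "\<ominus> \<one>" x y] by (simp add: bracket_closed minus_conv_smult)

text \<open>Polarization: expand [x + y, x + y] = 0. This direction from alternating to skew holds
  in every characteristic.\<close>

lemma bracket_skew:
  assumes "x \<in> carrier L" "y \<in> carrier L"
  shows "\<lbrace>y, x\<rbrace>\<^bsub>L\<^esub> = \<ominus>\<^bsub>L\<^esub> \<lbrace>x, y\<rbrace>\<^bsub>L\<^esub>"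
proof -
  have "\<lbrace>x \<oplus>\<^bsub>L\<^esub> y, x \<oplus>\<^bsub>L\<^esub> y\<rbrace>\<^bsub>L\<^esub> = \<lbrace>y, x\<rbrace>\<^bsub>L\<^esub> \<oplus>\<^bsub>L\<^esub> \<lbrace>x, y\<rbrace>\<^bsub>L\<^esub>"
    using assms
    by (subst bracket_l_distr)
      (simp_all add: bracket_r_distr bracket_closed bracket_alternating M.a_comm)
  moreover have "\<lbrace>x \<oplus>\<^bsub>L\<^esub> y, x \<oplus>\<^bsub>L\<^esub> y\<rbrace>\<^bsub>L\<^esub> = \<zero>\<^bsub>L\<^esub>"
    using assms by (intro bracket_alternating) simp
  ultimately have "\<lbrace>y, x\<rbrace>\<^bsub>L\<^esub> \<oplus>\<^bsub>L\<^esub> \<lbrace>x, y\<rbrace>\<^bsub>L\<^esub> = \<zero>\<^bsub>L\<^esub>" by metis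
  then have "\<ominus>\<^bsub>L\<^esub> \<lbrace>x, y\<rbrace>\<^bsub>L\<^esub> = \<lbrace>y, x\<rbrace>\<^bsub>L\<^esub>"
    using assms by (intro M.minus_equality bracket_closed)
  then show ?thesis by (rule HOL.sym)
qed

text \<open>The Jacobi identity in the shape of the first half of relation (iii), with the bracket
  in place of \<otimes>. It is what makes the bracket of F satisfy that relation.\<close>

lemma bracket_derivation:
  assumes [simp]: "x \<in> carrier L" "y \<in> carrier L" "z \<in> carrier L"
  shows "\<lbrace>\<lbrace>x, y\<rbrace>\<^bsub>L\<^esub>, z\<rbrace>\<^bsub>L\<^esub> = \<lbrace>x, \<lbrace>y, z\<rbrace>\<^bsub>L\<^esub>\<rbrace>\<^bsub>L\<^esub> \<oplus>\<^bsub>L\<^esub> (\<ominus>\<^bsub>L\<^esub> \<lbrace>y, \<lbrace>x, z\<rbrace>\<^bsub>L\<^esub>\<rbrace>\<^bsub>L\<^esub>)"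
proof -
  note [simp] = bracket_closed
  have "\<lbrace>x, \<lbrace>y, z\<rbrace>\<^bsub>L\<^esub>\<rbrace>\<^bsub>L\<^esub> \<oplus>\<^bsub>L\<^esub> (\<ominus>\<^bsub>L\<^esub> \<lbrace>y, \<lbrace>x, z\<rbrace>\<^bsub>L\<^esub>\<rbrace>\<^bsub>L\<^esub>) \<oplus>\<^bsub>L\<^esub> \<lbrace>z, \<lbrace>x, y\<rbrace>\<^bsub>L\<^esub>\<rbrace>\<^bsub>L\<^esub> = \<zero>\<^bsub>L\<^esub>"
    using jacobi[of x y z] bracket_skew[of x z] by (simp add: bracket_minus_r)
  then have "\<ominus>\<^bsub>L\<^esub> \<lbrace>z, \<lbrace>x, y\<rbrace>\<^bsub>L\<^esub>\<rbrace>\<^bsub>L\<^esub> = \<lbrace>x, \<lbrace>y, z\<rbrace>\<^bsub>L\<^esub>\<rbrace>\<^bsub>L\<^esub> \<oplus>\<^bsub>L\<^esub> (\<ominus>\<^bsub>L\<^esub> \<lbrace>y, \<lbrace>x, z\<rbrace>\<^bsub>L\<^esub>\<rbrace>\<^bsub>L\<^esub>)"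
    by (intro M.minus_equality) simp_all
  then show ?thesis using bracket_skew[of z "\<lbrace>x, y\<rbrace>\<^bsub>L\<^esub>"] by simp
qed

lemma lie_algebra_restrict:
  assumes "submodule N K L" "\<And>x y. x \<in> N \<Longrightarrow> y \<in> N \<Longrightarrow> \<lbrace>x, y\<rbrace>\<^bsub>L\<^esub> \<in> N"
  shows "lie_algebra K (L\<lparr>carrier := N\<rparr>)"
proof -
  have N: "x \<in> carrier L" if "x \<in> N" for x using assms(1) that by (auto simp: submodule_iff)
  have "module K (L\<lparr>carrier := N\<rparr>)"
    by (rule submodule.submodule_is_module[OF assms(1) module_axioms])
  then show ?thesis
    by (intro lie_algebra.intro lie_algebra_axioms.intro field_axioms)
      (simp_all add: assms(2) N bracket_l_distr bracket_r_distr bracket_smult_l bracket_smult_r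
        bracket_alternating jacobi)
qed

end

section \<open>Homomorphisms and transport of structure\<close>

lemma lie_homI:
  assumes "\<And>x. x \<in> carrier A \<Longrightarrow> h x \<in> carrier B"
    and "\<And>x y. x \<in> carrier A \<Longrightarrow> y \<in> carrier A \<Longrightarrow> h (x \<oplus>\<^bsub>A\<^esub> y) = h x \<oplus>\<^bsub>B\<^esub> h y"
    and "\<And>c x. c \<in> carrier K \<Longrightarrow> x \<in> carrier A \<Longrightarrow> h (c \<odot>\<^bsub>A\<^esub> x) = c \<odot>\<^bsub>B\<^esub> h x"
    and "\<And>x y. x \<in> carrier A \<Longrightarrow> y \<in> carrier A \<Longrightarrow> h \<lbrace>x, y\<rbrace>\<^bsub>A\<^esub> = \<lbrace>h x, h y\<rbrace>\<^bsub>B\<^esub>"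
  shows "h \<in> lie_hom K A B"
  using assms by (auto simp: lie_hom_def)

lemma lie_homD:
  assumes "h \<in> lie_hom K A B"
  shows lie_hom_closed: "x \<in> carrier A \<Longrightarrow> h x \<in> carrier B"
    and lie_hom_add: "x \<in> carrier A \<Longrightarrow> y \<in> carrier A \<Longrightarrow> h (x \<oplus>\<^bsub>A\<^esub> y) = h x \<oplus>\<^bsub>B\<^esub> h y"
    and lie_hom_smult: "c \<in> carrier K \<Longrightarrow> x \<in> carrier A \<Longrightarrow> h (c \<odot>\<^bsub>A\<^esub> x) = c \<odot>\<^bsub>B\<^esub> h x"
    and lie_hom_bracket: "x \<in> carrier A \<Longrightarrow> y \<in> carrier A \<Longrightarrow> h \<lbrace>x, y\<rbrace>\<^bsub>A\<^esub> = \<lbrace>h x, h y\<rbrace>\<^bsub>B\<^esub>"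
  using assms by (auto simp: lie_hom_def)

lemma lie_hom_zero:
  assumes "lie_algebra K A" "lie_algebra K B" "h \<in> lie_hom K A B"
  shows "h \<zero>\<^bsub>A\<^esub> = \<zero>\<^bsub>B\<^esub>"
proof -
  interpret A: lie_algebra K A by fact
  interpret B: lie_algebra K B by fact
  show ?thesis
    using lie_hom_smult[OF assms(3), of "\<zero>\<^bsub>K\<^esub>" "\<zero>\<^bsub>A\<^esub>"] lie_hom_closed[OF assms(3)]
    by simp
qed

lemma lie_hom_minus:
  assumes "lie_algebra K A" "lie_algebra K B" "h \<in> lie_hom K A B" "x \<in> carrier A"
  shows "h (\<ominus>\<^bsub>A\<^esub> x) = \<ominus>\<^bsub>B\<^esub> h x"
proof -
  interpret A: lie_algebra K A by fact
  interpret B: lie_algebra K B by fact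
  show ?thesis
    using lie_hom_smult[OF assms(3) _ assms(4), of "\<ominus>\<^bsub>K\<^esub> \<one>\<^bsub>K\<^esub>"] lie_hom_closed[OF assms(3,4)] assms(4)
    by (simp add: A.minus_conv_smult B.minus_conv_smult)
qed

lemma lie_hom_comp:
  "f \<in> lie_hom K A B \<Longrightarrow> g \<in> lie_hom K B C \<Longrightarrow> g \<circ> f \<in> lie_hom K A C"
  by (auto simp: lie_hom_def Pi_iff)

text \<open>Serves to carry the universal property of a presented algebra over to an algebra
  isomorphic to it.\<close>

lemma lie_iso_inv:
  assumes "lie_algebra K A" "f \<in> lie_iso K A B"
  shows "inv_into (carrier A) f \<in> lie_hom K B A"
proof -
  interpret A: lie_algebra K A by fact
  have f: "f \<in> lie_hom K A B" and bij: "bij_betw f (carrier A) (carrier B)"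
    using assms(2) by (auto simp: lie_iso_def)
  define g where "g = inv_into (carrier A) f"
  have g: "g y \<in> carrier A" "f (g y) = y" if "y \<in> carrier B" for y
    using bij that by (auto simp: g_def bij_betw_def inv_into_into f_inv_into_f)
  have gf: "g (f x) = x" if "x \<in> carrier A" for x
    using bij that by (auto simp: g_def bij_betw_def)
  have "g \<in> lie_hom K B A"
  proof (rule lie_homI)
    fix x y assume xy: "x \<in> carrier B" "y \<in> carrier B"
    show "g (x \<oplus>\<^bsub>B\<^esub> y) = g x \<oplus>\<^bsub>A\<^esub> g y"
      using gf[of "g x \<oplus>\<^bsub>A\<^esub> g y"] xy g by (simp add: lie_hom_add[OF f])
    show "g \<lbrace>x, y\<rbrace>\<^bsub>B\<^esub> = \<lbrace>g x, g y\<rbrace>\<^bsub>A\<^esub>"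
      using gf[of "\<lbrace>g x, g y\<rbrace>\<^bsub>A\<^esub>"] xy g by (simp add: lie_hom_bracket[OF f] A.bracket_closed)
  next
    fix c x assume xy: "c \<in> carrier K" "x \<in> carrier B"
    show "g (c \<odot>\<^bsub>B\<^esub> x) = c \<odot>\<^bsub>A\<^esub> g x"
      using gf[of "c \<odot>\<^bsub>A\<^esub> g x"] xy g by (simp add: lie_hom_smult[OF f])
  qed (use g in auto)
  then show ?thesis by (simp add: g_def)
qed

text \<open>The axioms are identities, so they pass to homomorphic images. \<open>B\<close> is a
  bare record here, whose zero is not yet known to be neutral; this is why \<open>zero\<close> is
  assumed instead of derived.\<close>

lemma lie_algebra_surj_image:
  assumes "lie_algebra K A" "h \<in> lie_hom K A B" and surj: "h ` carrier A = carrier B"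
    and zero: "h \<zero>\<^bsub>A\<^esub> = \<zero>\<^bsub>B\<^esub>"
  shows "lie_algebra K B"
proof -
  interpret A: lie_algebra K A by fact
  note h = lie_homD[OF assms(2)]
  have repr: "\<exists>a. a \<in> carrier A \<and> x = h a" if "x \<in> carrier B" for x
    using surj that by blast
  \<comment> \<open>Read from right to left, these equations fold an expression in \<open>B\<close>
    into \<open>h\<close> applied to one expression in \<open>A\<close>, where the axiom is
    known.\<close>
  note hs = h(2-4)[symmetric] zero[symmetric] A.bracket_closed
  show ?thesis
  proof (rule lie_algebraI)
    show "field K" by (rule A.field_axioms)
    show "\<zero>\<^bsub>B\<^esub> \<in> carrier B" using h(1)[of "\<zero>\<^bsub>A\<^esub>"] by (simp add: zero)
  next
    fix x y assume "x \<in> carrier B" "y \<in> carrier B"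
    then obtain a b where [simp]: "a \<in> carrier A" "b \<in> carrier A" and eq: "x = h a" "y = h b"
      using repr by metis
    show "x \<oplus>\<^bsub>B\<^esub> y \<in> carrier B" "\<lbrace>x, y\<rbrace>\<^bsub>B\<^esub> \<in> carrier B"
      unfolding eq by (simp_all add: hs h(1))
    show "x \<oplus>\<^bsub>B\<^esub> y = y \<oplus>\<^bsub>B\<^esub> x"
      unfolding eq by (simp add: hs A.M.a_comm)
  next
    fix x assume "x \<in> carrier B"
    then obtain a where [simp]: "a \<in> carrier A" and eq: "x = h a"
      using repr by metis
    show "\<zero>\<^bsub>B\<^esub> \<oplus>\<^bsub>B\<^esub> x = x" "((\<ominus>\<^bsub>K\<^esub> \<one>\<^bsub>K\<^esub>) \<odot>\<^bsub>B\<^esub> x) \<oplus>\<^bsub>B\<^esub> x = \<zero>\<^bsub>B\<^esub>"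
        "\<one>\<^bsub>K\<^esub> \<odot>\<^bsub>B\<^esub> x = x" "\<lbrace>x, x\<rbrace>\<^bsub>B\<^esub> = \<zero>\<^bsub>B\<^esub>"
      unfolding eq by (simp_all add: hs A.minus_conv_smult A.M.l_neg A.bracket_alternating)
  next
    fix c x y assume [simp]: "c \<in> carrier K" and "x \<in> carrier B" "y \<in> carrier B"
    then obtain a b where [simp]: "a \<in> carrier A" "b \<in> carrier A" and eq: "x = h a" "y = h b"
      using repr by metis
    show "c \<odot>\<^bsub>B\<^esub> (x \<oplus>\<^bsub>B\<^esub> y) = (c \<odot>\<^bsub>B\<^esub> x) \<oplus>\<^bsub>B\<^esub> (c \<odot>\<^bsub>B\<^esub> y)"
        "\<lbrace>c \<odot>\<^bsub>B\<^esub> x, y\<rbrace>\<^bsub>B\<^esub> = c \<odot>\<^bsub>B\<^esub> \<lbrace>x, y\<rbrace>\<^bsub>B\<^esub>" "\<lbrace>x, c \<odot>\<^bsub>B\<^esub> y\<rbrace>\<^bsub>B\<^esub> = c \<odot>\<^bsub>B\<^esub> \<lbrace>x, y\<rbrace>\<^bsub>B\<^esub>"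
      unfolding eq by (simp_all add: hs A.smult_r_distr A.bracket_smult_l A.bracket_smult_r)
  next
    fix c d x assume [simp]: "c \<in> carrier K" "d \<in> carrier K" and "x \<in> carrier B"
    then obtain a where [simp]: "a \<in> carrier A" and eq: "x = h a"
      using repr by metis
    show "(c \<oplus>\<^bsub>K\<^esub> d) \<odot>\<^bsub>B\<^esub> x = (c \<odot>\<^bsub>B\<^esub> x) \<oplus>\<^bsub>B\<^esub> (d \<odot>\<^bsub>B\<^esub> x)"
        "(c \<otimes>\<^bsub>K\<^esub> d) \<odot>\<^bsub>B\<^esub> x = c \<odot>\<^bsub>B\<^esub> (d \<odot>\<^bsub>B\<^esub> x)"
      unfolding eq by (simp_all add: hs A.smult_l_distr A.smult_assoc1)
  next
    fix x y z assume "x \<in> carrier B" "y \<in> carrier B" "z \<in> carrier B"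
    then obtain a b c where [simp]: "a \<in> carrier A" "b \<in> carrier A" "c \<in> carrier A"
      and eq: "x = h a" "y = h b" "z = h c"
      using repr by metis
    show "(x \<oplus>\<^bsub>B\<^esub> y) \<oplus>\<^bsub>B\<^esub> z = x \<oplus>\<^bsub>B\<^esub> (y \<oplus>\<^bsub>B\<^esub> z)"
      unfolding eq by (simp add: hs A.M.a_assoc)
    show "\<lbrace>x \<oplus>\<^bsub>B\<^esub> y, z\<rbrace>\<^bsub>B\<^esub> = \<lbrace>x, z\<rbrace>\<^bsub>B\<^esub> \<oplus>\<^bsub>B\<^esub> \<lbrace>y, z\<rbrace>\<^bsub>B\<^esub>" "\<lbrace>x, y \<oplus>\<^bsub>B\<^esub> z\<rbrace>\<^bsub>B\<^esub> = \<lbrace>x, y\<rbrace>\<^bsub>B\<^esub> \<oplus>\<^bsub>B\<^esub> \<lbrace>x, z\<rbrace>\<^bsub>B\<^esub>"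
      unfolding eq by (simp_all add: hs A.bracket_l_distr A.bracket_r_distr)
    show "\<lbrace>x, \<lbrace>y, z\<rbrace>\<^bsub>B\<^esub>\<rbrace>\<^bsub>B\<^esub> \<oplus>\<^bsub>B\<^esub> \<lbrace>y, \<lbrace>z, x\<rbrace>\<^bsub>B\<^esub>\<rbrace>\<^bsub>B\<^esub> \<oplus>\<^bsub>B\<^esub> \<lbrace>z, \<lbrace>x, y\<rbrace>\<^bsub>B\<^esub>\<rbrace>\<^bsub>B\<^esub> = \<zero>\<^bsub>B\<^esub>"
      unfolding eq by (simp add: hs A.jacobi)
  next
    fix c x assume [simp]: "c \<in> carrier K" and "x \<in> carrier B"
    then obtain a where [simp]: "a \<in> carrier A" and eq: "x = h a"
      using repr by metis
    show "c \<odot>\<^bsub>B\<^esub> x \<in> carrier B"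
      unfolding eq by (simp add: hs h(1))
  qed
qed


section \<open>Quotients\<close>

context lie_algebra
begin

text \<open>\<open>lie_ideal\<close> only asks for brackets with the element of the ideal on the
  left; skew-symmetry supplies the other side.\<close>

lemma lie_ideal_bracket_r:
  assumes "lie_ideal K L I" "x \<in> carrier L" "y \<in> I"
  shows "\<lbrace>x, y\<rbrace>\<^bsub>L\<^esub> \<in> I"
proof -
  have I: "submodule I K L" using assms(1) by (simp add: lie_ideal_def)
  have y: "y \<in> carrier L" using assms(3) submoduleE(1)[OF I] by blast
  have "\<lbrace>y, x\<rbrace>\<^bsub>L\<^esub> \<in> I" using assms by (simp add: lie_ideal_def)
  then show ?thesis
    using submoduleE(3)[OF I] bracket_skew[OF y assms(2)] by simp
qed

lemma submodule_abelian_subgroup: "submodule I K L \<Longrightarrow> abelian_subgroup I L"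
  by (intro abelian_subgroupI2 M.a_comm_group) (simp add: submodule_def)

lemma coset_eq_iff:
  assumes I: "submodule I K L" and [simp]: "x \<in> carrier L" "y \<in> carrier L"
  shows "I +>\<^bsub>L\<^esub> x = I +>\<^bsub>L\<^esub> y \<longleftrightarrow> x \<oplus>\<^bsub>L\<^esub> (\<ominus>\<^bsub>L\<^esub> y) \<in> I"
proof
  assume "I +>\<^bsub>L\<^esub> x = I +>\<^bsub>L\<^esub> y"
  moreover have "x \<in> I +>\<^bsub>L\<^esub> x"
    using abelian_subgroup.a_rcos_self[OF submodule_abelian_subgroup[OF I]] by simp
  ultimately obtain i where i: "i \<in> I" "x = i \<oplus>\<^bsub>L\<^esub> y"
    by (auto simp: a_r_coset_def')
  moreover from i have "i \<in> carrier L" using submoduleE(1)[OF I] by blast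
  ultimately show "x \<oplus>\<^bsub>L\<^esub> (\<ominus>\<^bsub>L\<^esub> y) \<in> I" by (simp add: M.a_assoc M.r_neg)
next
  have sub: "subgroup I (add_monoid L)" using I by (simp add: submodule_def)
  assume i: "x \<oplus>\<^bsub>L\<^esub> (\<ominus>\<^bsub>L\<^esub> y) \<in> I"
  have "x = (x \<oplus>\<^bsub>L\<^esub> (\<ominus>\<^bsub>L\<^esub> y)) \<oplus>\<^bsub>L\<^esub> y" by (simp add: M.a_assoc M.l_neg)
  with i have "x \<in> I +>\<^bsub>L\<^esub> y" unfolding a_r_coset_def' by blast
  then have "I +>\<^bsub>L\<^esub> y = I +>\<^bsub>L\<^esub> x"
    by (intro M.a_repr_independence[OF _ _ sub]) auto
  then show "I +>\<^bsub>L\<^esub> x = I +>\<^bsub>L\<^esub> y" by (rule HOL.sym)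
qed

lemma lie_quotient_ops:
  assumes I: "lie_ideal K L I" and x [simp]: "x \<in> carrier L"
  shows lie_quotient_add: "y \<in> carrier L \<Longrightarrow>
      (I +>\<^bsub>L\<^esub> x) \<oplus>\<^bsub>lie_quotient L I\<^esub> (I +>\<^bsub>L\<^esub> y) = I +>\<^bsub>L\<^esub> (x \<oplus>\<^bsub>L\<^esub> y)"
    and lie_quotient_smult: "c \<in> carrier K \<Longrightarrow>
      c \<odot>\<^bsub>lie_quotient L I\<^esub> (I +>\<^bsub>L\<^esub> x) = I +>\<^bsub>L\<^esub> (c \<odot>\<^bsub>L\<^esub> x)"
    and lie_quotient_bracket: "y \<in> carrier L \<Longrightarrow>
      \<lbrace>I +>\<^bsub>L\<^esub> x, I +>\<^bsub>L\<^esub> y\<rbrace>\<^bsub>lie_quotient L I\<^esub> = I +>\<^bsub>L\<^esub> \<lbrace>x, y\<rbrace>\<^bsub>L\<^esub>"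
proof -
  have S: "submodule I K L" using I by (simp add: lie_ideal_def)
  interpret abelian_subgroup I L
    by (rule submodule_abelian_subgroup[OF S])
  note closed = submoduleE(3-5)[OF S]
  have mem: "a \<in> carrier L \<and> a \<oplus>\<^bsub>L\<^esub> (\<ominus>\<^bsub>L\<^esub> z) \<in> I" if "a \<in> I +>\<^bsub>L\<^esub> z" "z \<in> carrier L" for a z
    using that submoduleE(1)[OF S] by (auto simp: a_r_coset_def' M.a_assoc M.r_neg)
  have self: "z \<in> I +>\<^bsub>L\<^esub> z" if "z \<in> carrier L" for z
    using that by (rule a_rcos_self)
  show "(I +>\<^bsub>L\<^esub> x) \<oplus>\<^bsub>lie_quotient L I\<^esub> (I +>\<^bsub>L\<^esub> y) = I +>\<^bsub>L\<^esub> (x \<oplus>\<^bsub>L\<^esub> y)" if "y \<in> carrier L" for y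
    using that by (simp add: lie_quotient_def a_rcos_sum)
  show "c \<odot>\<^bsub>lie_quotient L I\<^esub> (I +>\<^bsub>L\<^esub> x) = I +>\<^bsub>L\<^esub> (c \<odot>\<^bsub>L\<^esub> x)" if [simp]: "c \<in> carrier K" for c
  proof -
    have "I +>\<^bsub>L\<^esub> (c \<odot>\<^bsub>L\<^esub> a) = I +>\<^bsub>L\<^esub> (c \<odot>\<^bsub>L\<^esub> x)" if "a \<in> I +>\<^bsub>L\<^esub> x" for a
    proof -
      have [simp]: "a \<in> carrier L" using mem[OF that] by simp
      have "c \<odot>\<^bsub>L\<^esub> (a \<oplus>\<^bsub>L\<^esub> (\<ominus>\<^bsub>L\<^esub> x)) \<in> I" using mem[OF that] closed(2) by simp
      then show ?thesis by (simp add: coset_eq_iff[OF S] smult_r_distr smult_r_minus)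
    qed
    then have "(\<Union>a\<in>I +>\<^bsub>L\<^esub> x. I +>\<^bsub>L\<^esub> (c \<odot>\<^bsub>L\<^esub> a)) = I +>\<^bsub>L\<^esub> (c \<odot>\<^bsub>L\<^esub> x)"
      by (intro UN_constant_eq[OF self[OF x]] ballI)
    then show ?thesis by (simp add: lie_quotient_def)
  qed
  show "\<lbrace>I +>\<^bsub>L\<^esub> x, I +>\<^bsub>L\<^esub> y\<rbrace>\<^bsub>lie_quotient L I\<^esub> = I +>\<^bsub>L\<^esub> \<lbrace>x, y\<rbrace>\<^bsub>L\<^esub>" if y [simp]: "y \<in> carrier L" for y
  proof -
    note [simp] = bracket_closed
    have eq: "I +>\<^bsub>L\<^esub> \<lbrace>a, b\<rbrace>\<^bsub>L\<^esub> = I +>\<^bsub>L\<^esub> \<lbrace>x, y\<rbrace>\<^bsub>L\<^esub>" if "a \<in> I +>\<^bsub>L\<^esub> x" "b \<in> I +>\<^bsub>L\<^esub> y" for a b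
    proof -
      have [simp]: "a \<in> carrier L" "b \<in> carrier L" using mem that by auto
      \<comment> \<open>Representatives are exchanged one argument at a time: [a, b] - [x, b] =
        [a - x, b] and [x, b] - [x, y] = [x, b - y] both lie in \<open>I\<close>.\<close>
      have "\<lbrace>a \<oplus>\<^bsub>L\<^esub> (\<ominus>\<^bsub>L\<^esub> x), b\<rbrace>\<^bsub>L\<^esub> \<in> I"
        using I mem[OF that(1)] by (simp add: lie_ideal_def)
      then have "I +>\<^bsub>L\<^esub> \<lbrace>a, b\<rbrace>\<^bsub>L\<^esub> = I +>\<^bsub>L\<^esub> \<lbrace>x, b\<rbrace>\<^bsub>L\<^esub>"
        by (simp add: coset_eq_iff[OF S] bracket_l_distr bracket_minus_l)
      moreover have "\<lbrace>x, b \<oplus>\<^bsub>L\<^esub> (\<ominus>\<^bsub>L\<^esub> y)\<rbrace>\<^bsub>L\<^esub> \<in> I"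
        using mem[OF that(2)] by (intro lie_ideal_bracket_r[OF I]) auto
      then have "I +>\<^bsub>L\<^esub> \<lbrace>x, b\<rbrace>\<^bsub>L\<^esub> = I +>\<^bsub>L\<^esub> \<lbrace>x, y\<rbrace>\<^bsub>L\<^esub>"
        by (simp add: coset_eq_iff[OF S] bracket_r_distr bracket_minus_r)
      ultimately show ?thesis by simp
    qed
    have "(\<Union>a\<in>I +>\<^bsub>L\<^esub> x. \<Union>b\<in>I +>\<^bsub>L\<^esub> y. I +>\<^bsub>L\<^esub> \<lbrace>a, b\<rbrace>\<^bsub>L\<^esub>) = I +>\<^bsub>L\<^esub> \<lbrace>x, y\<rbrace>\<^bsub>L\<^esub>"
      using eq by (intro UN_constant_eq[OF self[OF x]] UN_constant_eq[OF self[OF y]] ballI)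
    then show ?thesis by (simp add: lie_quotient_def)
  qed
qed

lemma carrier_lie_quotient: "carrier (lie_quotient L I) = (\<lambda>x. I +>\<^bsub>L\<^esub> x) ` carrier L"
  by (auto simp: lie_quotient_def A_RCOSETS_def')

lemma lie_quotient_proj_hom:
  "lie_ideal K L I \<Longrightarrow> (\<lambda>x. I +>\<^bsub>L\<^esub> x) \<in> lie_hom K L (lie_quotient L I)"
  by (intro lie_homI) (simp_all add: lie_quotient_ops carrier_lie_quotient)

lemma lie_algebra_quotient:
  assumes "lie_ideal K L I"
  shows "lie_algebra K (lie_quotient L I)"
proof (rule lie_algebra_surj_image[OF lie_algebra_axioms lie_quotient_proj_hom[OF assms]])
  show "(\<lambda>x. I +>\<^bsub>L\<^esub> x) ` carrier L = carrier (lie_quotient L I)"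
    by (simp add: carrier_lie_quotient)
  have "I \<subseteq> carrier L" using assms submoduleE(1) by (simp add: lie_ideal_def)
  then show "I +>\<^bsub>L\<^esub> \<zero>\<^bsub>L\<^esub> = \<zero>\<^bsub>lie_quotient L I\<^esub>"
    by (simp add: lie_quotient_def)
qed

lemma lie_quotient_lift:
  assumes I: "lie_ideal K L I" and B: "lie_algebra K B" and h: "h \<in> lie_hom K L B"
    and kernel: "\<And>x. x \<in> I \<Longrightarrow> h x = \<zero>\<^bsub>B\<^esub>"
  obtains h' where "h' \<in> lie_hom K (lie_quotient L I) B"
    and "\<And>x. x \<in> carrier L \<Longrightarrow> h' (I +>\<^bsub>L\<^esub> x) = h x"
proof -
  interpret B: lie_algebra K B by fact
  have S: "submodule I K L" using I by (simp add: lie_ideal_def)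
  \<comment> \<open>The value is taken at an arbitrary representative. Two representatives differ by
    an element of \<open>I\<close>, which \<open>h\<close> kills, so the choice is
    immaterial.\<close>
  define h' where "h' A = h (SOME a. a \<in> carrier L \<and> A = I +>\<^bsub>L\<^esub> a)" for A
  have h': "h' (I +>\<^bsub>L\<^esub> x) = h x" if x: "x \<in> carrier L" for x
  proof -
    define a where "a = (SOME a. a \<in> carrier L \<and> I +>\<^bsub>L\<^esub> x = I +>\<^bsub>L\<^esub> a)"
    have a: "a \<in> carrier L \<and> I +>\<^bsub>L\<^esub> x = I +>\<^bsub>L\<^esub> a"
      unfolding a_def by (rule someI[of _ x]) (use x in simp)
    then have "x \<oplus>\<^bsub>L\<^esub> (\<ominus>\<^bsub>L\<^esub> a) \<in> I" using coset_eq_iff[OF S x, of a] by simp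
    then have "h (x \<oplus>\<^bsub>L\<^esub> (\<ominus>\<^bsub>L\<^esub> a)) = \<zero>\<^bsub>B\<^esub>" by (rule kernel)
    then have "h x \<oplus>\<^bsub>B\<^esub> (\<ominus>\<^bsub>B\<^esub> h a) = \<zero>\<^bsub>B\<^esub>"
      using a x lie_hom_add[OF h] lie_hom_minus[OF lie_algebra_axioms B h] by simp
    then have "h x = h a"
      using a x lie_hom_closed[OF h] by (metis B.M.minus_equality B.M.minus_minus B.M.a_inv_closed)
    then show ?thesis by (simp add: h'_def a_def)
  qed
  have "h' \<in> lie_hom K (lie_quotient L I) B"
    by (rule lie_homI)
      (auto simp: carrier_lie_quotient h' bracket_closed lie_quotient_ops[OF I] lie_homD[OF h])
  with h' show ?thesis using that by blast
qed

end


section \<open>Generators and relations\<close>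

lemma Neg_in_lie_terms: "field K \<Longrightarrow> t \<in> lie_terms K X \<Longrightarrow> Neg K t \<in> lie_terms K X"
  unfolding Neg_def
  by (intro lie_terms.Scale) (simp_all add: field_def domain_def cring_def ring.ring_simprules)

text \<open>Makes \<open>lie_cong\<close> a relation on well-formed terms. The rule
  \<open>rel\<close> filters the pairs of \<open>S\<close> for this purpose, and
  \<open>add_neg\<close> is where -1 has to be a scalar of \<open>K\<close>.\<close>

lemma lie_cong_in_terms:
  assumes "field K" "(s, t) \<in> lie_cong K X S"
  shows "s \<in> lie_terms K X \<and> t \<in> lie_terms K X"
proof -
  interpret K: field K by fact
  from assms(2) show ?thesis
    by induction (auto intro!: lie_terms.intros simp: Neg_in_lie_terms[OF assms(1)])
qed

lemma equiv_lie_cong: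
  assumes "field K"
  shows "equiv (lie_terms K X) (lie_cong K X S)"
proof (rule equivI)
  show "lie_cong K X S \<subseteq> lie_terms K X \<times> lie_terms K X"
    using lie_cong_in_terms[OF assms] by auto
qed (auto simp: refl_on_def sym_def trans_def intro: lie_cong.refl lie_cong.sym lie_cong.trans)

lemma lie_cong_class_eq_iff:
  assumes "field K" "s \<in> lie_terms K X" "t \<in> lie_terms K X"
  shows "lie_cong K X S `` {s} = lie_cong K X S `` {t} \<longleftrightarrow> (s, t) \<in> lie_cong K X S"
  using eq_equiv_class_iff[OF equiv_lie_cong[OF assms(1)] assms(2,3)] .

lemma carrier_lie_presented:
  "carrier (lie_presented K X S) = (\<lambda>t. lie_cong K X S `` {t}) ` lie_terms K X"
  by (auto simp: lie_presented_def quotient_def)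

lemma lie_presented_ops:
  assumes K: "field K" and s: "s \<in> lie_terms K X"
  shows lie_presented_add: "t \<in> lie_terms K X \<Longrightarrow>
      (lie_cong K X S `` {s}) \<oplus>\<^bsub>lie_presented K X S\<^esub> (lie_cong K X S `` {t}) = lie_cong K X S `` {Add s t}"
    and lie_presented_smult: "c \<in> carrier K \<Longrightarrow>
      c \<odot>\<^bsub>lie_presented K X S\<^esub> (lie_cong K X S `` {s}) = lie_cong K X S `` {Scale c s}"
    and lie_presented_bracket: "t \<in> lie_terms K X \<Longrightarrow>
      \<lbrace>lie_cong K X S `` {s}, lie_cong K X S `` {t}\<rbrace>\<^bsub>lie_presented K X S\<^esub> = lie_cong K X S `` {Br s t}"
proof -
  note E = equiv_lie_cong[OF K, of X S]
  note class_eq = equiv_class_eq[OF E]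
  show "(lie_cong K X S `` {s}) \<oplus>\<^bsub>lie_presented K X S\<^esub> (lie_cong K X S `` {t}) = lie_cong K X S `` {Add s t}"
    if "t \<in> lie_terms K X"
    using UN_equiv_class2[OF E E _ s that, of "\<lambda>s t. lie_cong K X S `` {Add s t}"]
    by (auto simp: lie_presented_def congruent2_def intro!: class_eq lie_cong.cong_Add)
  show "c \<odot>\<^bsub>lie_presented K X S\<^esub> (lie_cong K X S `` {s}) = lie_cong K X S `` {Scale c s}"
    if "c \<in> carrier K"
    using UN_equiv_class[OF E _ s, of "\<lambda>t. lie_cong K X S `` {Scale c t}"] that
    by (auto simp: lie_presented_def congruent_def intro!: class_eq lie_cong.cong_Scale)
  show "\<lbrace>lie_cong K X S `` {s}, lie_cong K X S `` {t}\<rbrace>\<^bsub>lie_presented K X S\<^esub> = lie_cong K X S `` {Br s t}"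
    if "t \<in> lie_terms K X"
    using UN_equiv_class2[OF E E _ s that, of "\<lambda>s t. lie_cong K X S `` {Br s t}"]
    by (auto simp: lie_presented_def congruent2_def intro!: class_eq lie_cong.cong_Br)
qed

text \<open>Once the operations are computed on representatives, each axiom is one generating rule
  of \<open>lie_cong\<close>, whatever the relations \<open>S\<close> are.\<close>

lemma lie_algebra_presented:
  assumes K: "field K"
  shows "lie_algebra K (lie_presented K X S)"
proof -
  interpret K: field K by fact
  let ?P = "lie_presented K X S" and ?T = "lie_terms K X"
  have zero: "\<zero>\<^bsub>?P\<^esub> = lie_cong K X S `` {Null}" by (simp add: lie_presented_def)
  have repr: "\<exists>t. t \<in> ?T \<and> x = lie_cong K X S `` {t}" if "x \<in> carrier ?P" for x
    using that by (auto simp: carrier_lie_presented)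
  note T = lie_terms.intros(2-)
  note s = lie_presented_ops[OF K] zero lie_cong_class_eq_iff[OF K] T
  note carr = image_eqI[OF HOL.refl, where f = "\<lambda>t. lie_cong K X S `` {t}"]
  have neg: "Neg K t \<in> ?T" if "t \<in> ?T" for t using Neg_in_lie_terms[OF K that] .
  show ?thesis
  proof (rule lie_algebraI)
    show "field K" by fact
    show "\<zero>\<^bsub>?P\<^esub> \<in> carrier ?P"
      by (auto simp: zero carrier_lie_presented intro: carr T)
  next
    fix x y assume "x \<in> carrier ?P" "y \<in> carrier ?P"
    then obtain a b where [simp]: "a \<in> ?T" "b \<in> ?T"
      and eq: "x = lie_cong K X S `` {a}" "y = lie_cong K X S `` {b}"
      using repr by metis
    show "x \<oplus>\<^bsub>?P\<^esub> y \<in> carrier ?P" "\<lbrace>x, y\<rbrace>\<^bsub>?P\<^esub> \<in> carrier ?P"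
      unfolding eq by (auto simp: s carrier_lie_presented intro!: carr)
    show "x \<oplus>\<^bsub>?P\<^esub> y = y \<oplus>\<^bsub>?P\<^esub> x"
      unfolding eq by (simp add: s lie_cong.add_comm)
  next
    fix x assume "x \<in> carrier ?P"
    then obtain a where [simp]: "a \<in> ?T" and eq: "x = lie_cong K X S `` {a}"
      using repr by metis
    show "\<zero>\<^bsub>?P\<^esub> \<oplus>\<^bsub>?P\<^esub> x = x" "\<one>\<^bsub>K\<^esub> \<odot>\<^bsub>?P\<^esub> x = x" "\<lbrace>x, x\<rbrace>\<^bsub>?P\<^esub> = \<zero>\<^bsub>?P\<^esub>"
      unfolding eq by (simp_all add: s lie_cong.add_null lie_cong.scale_one lie_cong.br_alternating)
    show "((\<ominus>\<^bsub>K\<^esub> \<one>\<^bsub>K\<^esub>) \<odot>\<^bsub>?P\<^esub> x) \<oplus>\<^bsub>?P\<^esub> x = \<zero>\<^bsub>?P\<^esub>"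
      unfolding eq by (simp add: s lie_cong.add_neg[unfolded Neg_def])
  next
    fix c x assume [simp]: "c \<in> carrier K" and "x \<in> carrier ?P"
    then obtain a where [simp]: "a \<in> ?T" and eq: "x = lie_cong K X S `` {a}"
      using repr by metis
    show "c \<odot>\<^bsub>?P\<^esub> x \<in> carrier ?P"
      unfolding eq by (auto simp: s carrier_lie_presented intro!: carr)
  next
    fix c x y assume [simp]: "c \<in> carrier K" and "x \<in> carrier ?P" "y \<in> carrier ?P"
    then obtain a b where [simp]: "a \<in> ?T" "b \<in> ?T"
      and eq: "x = lie_cong K X S `` {a}" "y = lie_cong K X S `` {b}"
      using repr by metis
    show "c \<odot>\<^bsub>?P\<^esub> (x \<oplus>\<^bsub>?P\<^esub> y) = (c \<odot>\<^bsub>?P\<^esub> x) \<oplus>\<^bsub>?P\<^esub> (c \<odot>\<^bsub>?P\<^esub> y)"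
        "\<lbrace>c \<odot>\<^bsub>?P\<^esub> x, y\<rbrace>\<^bsub>?P\<^esub> = c \<odot>\<^bsub>?P\<^esub> \<lbrace>x, y\<rbrace>\<^bsub>?P\<^esub>" "\<lbrace>x, c \<odot>\<^bsub>?P\<^esub> y\<rbrace>\<^bsub>?P\<^esub> = c \<odot>\<^bsub>?P\<^esub> \<lbrace>x, y\<rbrace>\<^bsub>?P\<^esub>"
      unfolding eq by (simp_all add: s lie_cong.scale_r_distr lie_cong.br_scale_l lie_cong.br_scale_r)
  next
    fix c d x assume [simp]: "c \<in> carrier K" "d \<in> carrier K" and "x \<in> carrier ?P"
    then obtain a where [simp]: "a \<in> ?T" and eq: "x = lie_cong K X S `` {a}"
      using repr by metis
    show "(c \<oplus>\<^bsub>K\<^esub> d) \<odot>\<^bsub>?P\<^esub> x = (c \<odot>\<^bsub>?P\<^esub> x) \<oplus>\<^bsub>?P\<^esub> (d \<odot>\<^bsub>?P\<^esub> x)"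
        "(c \<otimes>\<^bsub>K\<^esub> d) \<odot>\<^bsub>?P\<^esub> x = c \<odot>\<^bsub>?P\<^esub> (d \<odot>\<^bsub>?P\<^esub> x)"
      unfolding eq by (simp_all add: s lie_cong.scale_l_distr lie_cong.scale_assoc)
  next
    fix x y z assume "x \<in> carrier ?P" "y \<in> carrier ?P" "z \<in> carrier ?P"
    then obtain a b c where [simp]: "a \<in> ?T" "b \<in> ?T" "c \<in> ?T"
      and eq: "x = lie_cong K X S `` {a}" "y = lie_cong K X S `` {b}" "z = lie_cong K X S `` {c}"
      using repr by metis
    show "(x \<oplus>\<^bsub>?P\<^esub> y) \<oplus>\<^bsub>?P\<^esub> z = x \<oplus>\<^bsub>?P\<^esub> (y \<oplus>\<^bsub>?P\<^esub> z)"
      unfolding eq by (simp add: s lie_cong.add_assoc)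
    show "\<lbrace>x \<oplus>\<^bsub>?P\<^esub> y, z\<rbrace>\<^bsub>?P\<^esub> = \<lbrace>x, z\<rbrace>\<^bsub>?P\<^esub> \<oplus>\<^bsub>?P\<^esub> \<lbrace>y, z\<rbrace>\<^bsub>?P\<^esub>" "\<lbrace>x, y \<oplus>\<^bsub>?P\<^esub> z\<rbrace>\<^bsub>?P\<^esub> = \<lbrace>x, y\<rbrace>\<^bsub>?P\<^esub> \<oplus>\<^bsub>?P\<^esub> \<lbrace>x, z\<rbrace>\<^bsub>?P\<^esub>"
      unfolding eq by (simp_all add: s lie_cong.br_l_distr lie_cong.br_r_distr)
    show "\<lbrace>x, \<lbrace>y, z\<rbrace>\<^bsub>?P\<^esub>\<rbrace>\<^bsub>?P\<^esub> \<oplus>\<^bsub>?P\<^esub> \<lbrace>y, \<lbrace>z, x\<rbrace>\<^bsub>?P\<^esub>\<rbrace>\<^bsub>?P\<^esub> \<oplus>\<^bsub>?P\<^esub> \<lbrace>z, \<lbrace>x, y\<rbrace>\<^bsub>?P\<^esub>\<rbrace>\<^bsub>?P\<^esub> = \<zero>\<^bsub>?P\<^esub>"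
      unfolding eq by (simp add: s lie_cong.br_jacobi)
  qed
qed

section \<open>Evaluation of terms and universal properties\<close>

primrec lie_eval :: "('k, 'a, 'n) lie_alg_scheme \<Rightarrow> ('x \<Rightarrow> 'a) \<Rightarrow> ('k, 'x) lie_term \<Rightarrow> 'a" where
  "lie_eval B g (Gen x) = g x"
| "lie_eval B g Null = \<zero>\<^bsub>B\<^esub>"
| "lie_eval B g (Add s t) = lie_eval B g s \<oplus>\<^bsub>B\<^esub> lie_eval B g t"
| "lie_eval B g (Scale c t) = c \<odot>\<^bsub>B\<^esub> lie_eval B g t"
| "lie_eval B g (Br s t) = \<lbrace>lie_eval B g s, lie_eval B g t\<rbrace>\<^bsub>B\<^esub>"

context lie_algebra
begin

lemma lie_eval_closed:
  assumes "g \<in> X \<rightarrow> carrier L" "t \<in> lie_terms K X"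
  shows "lie_eval L g t \<in> carrier L"
  using assms(2) by induction (use assms(1) in \<open>auto simp: bracket_closed\<close>)

lemma lie_eval_Neg:
  assumes "g \<in> X \<rightarrow> carrier L" "t \<in> lie_terms K X"
  shows "lie_eval L g (Neg K t) = \<ominus>\<^bsub>L\<^esub> lie_eval L g t"
  using lie_eval_closed[OF assms] by (simp add: Neg_def minus_conv_smult)

text \<open>Soundness of the congruence: apart from the relations in \<open>S\<close>, every
  generating rule is an identity valid in all Lie algebras or a closure property of
  equality.\<close>

lemma lie_eval_cong:
  assumes g: "g \<in> X \<rightarrow> carrier L"
    and rels: "\<And>s t. (s, t) \<in> S \<Longrightarrow> s \<in> lie_terms K X \<Longrightarrow> t \<in> lie_terms K X \<Longrightarrow>
      lie_eval L g s = lie_eval L g t"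
    and "(s, t) \<in> lie_cong K X S"
  shows "lie_eval L g s = lie_eval L g t"
  using assms(3)
proof induction
  case (add_comm s t)
  then show ?case by (simp add: lie_eval_closed[OF g] M.a_comm)
next
  case (br_jacobi s t u)
  then show ?case by (simp add: lie_eval_closed[OF g] jacobi)
qed (simp_all add: rels lie_eval_closed[OF g] lie_eval_Neg[OF g] M.a_assoc M.l_neg
      smult_l_distr smult_r_distr smult_assoc1 bracket_l_distr bracket_r_distr
      bracket_smult_l bracket_smult_r bracket_alternating bracket_closed)

text \<open>Existence half of the universal property of generators and relations. Evaluation is
  constant on congruence classes, so it may be computed at any chosen representative.\<close>

lemma lie_presented_lift:
  assumes g: "g \<in> X \<rightarrow> carrier L"
    and rels: "\<And>s t. (s, t) \<in> S \<Longrightarrow> s \<in> lie_terms K X \<Longrightarrow> t \<in> lie_terms K X \<Longrightarrow>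
      lie_eval L g s = lie_eval L g t"
  obtains h where "h \<in> lie_hom K (lie_presented K X S) L"
    and "\<And>x. x \<in> X \<Longrightarrow> h (lie_cong K X S `` {Gen x}) = g x"
proof -
  define h where "h A = lie_eval L g (SOME t. t \<in> A)" for A
  have h: "h (lie_cong K X S `` {t}) = lie_eval L g t" if "t \<in> lie_terms K X" for t
  proof -
    have "(t, SOME u. u \<in> lie_cong K X S `` {t}) \<in> lie_cong K X S"
      using someI[of "\<lambda>u. u \<in> lie_cong K X S `` {t}" t] lie_cong.refl[OF that] by auto
    from lie_eval_cong[OF g rels this] show ?thesis by (simp add: h_def)
  qed
  have "h \<in> lie_hom K (lie_presented K X S) L"
    by (rule lie_homI)
      (auto simp: carrier_lie_presented h lie_presented_ops[OF field_axioms] lie_terms.intros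
        lie_eval_closed[OF g])
  then show ?thesis using that[of h] by (simp add: h lie_terms.Gen)
qed

end

text \<open>Uniqueness half: every class is built from generators by the operations, so induction on
  terms suffices.\<close>

lemma lie_presented_hom_eq:
  assumes K: "field K" and B: "lie_algebra K B"
    and f: "f \<in> lie_hom K (lie_presented K X S) B" and g: "g \<in> lie_hom K (lie_presented K X S) B"
    and eq: "\<And>x. x \<in> X \<Longrightarrow> f (lie_cong K X S `` {Gen x}) = g (lie_cong K X S `` {Gen x})"
    and x: "x \<in> carrier (lie_presented K X S)"
  shows "f x = g x"
proof -
  let ?P = "lie_presented K X S"
  have zero: "\<zero>\<^bsub>?P\<^esub> = lie_cong K X S `` {Null}" by (simp add: lie_presented_def)
  have carr: "lie_cong K X S `` {t} \<in> carrier ?P" if "t \<in> lie_terms K X" for t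
    using that by (auto simp: carrier_lie_presented)
  have "f (lie_cong K X S `` {t}) = g (lie_cong K X S `` {t})" if "t \<in> lie_terms K X" for t
    using that
  proof induction
    case Null
    show ?case
      using lie_hom_zero[OF lie_algebra_presented[OF K] B f]
        lie_hom_zero[OF lie_algebra_presented[OF K] B g] by (simp add: zero)
  qed (simp_all add: eq lie_presented_ops[OF K, symmetric] carr lie_homD[OF f] lie_homD[OF g])
  then show ?thesis using x by (auto simp: carrier_lie_presented)
qed

text \<open>Freeness is defined by an isomorphism with the algebra presented by no relations. There
  every assignment of generators lifts, and composing with the inverse isomorphism moves the lift to
  \<open>F\<close>.\<close>

lemma free_lie_on_lift:
  assumes F: "free_lie_on K F X" and B: "lie_algebra K B" and g: "g \<in> X \<rightarrow> carrier B"
  obtains h where "h \<in> lie_hom K F B" and "\<And>x. x \<in> X \<Longrightarrow> h x = g x"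
proof -
  interpret B: lie_algebra K B by fact
  let ?P = "lie_presented K X {}"
  obtain \<phi> where \<phi>: "\<phi> \<in> lie_iso K ?P F"
    and gens: "\<And>x. x \<in> X \<Longrightarrow> \<phi> (lie_cong K X {} `` {Gen x}) = x"
    using F by (auto simp: free_lie_on_def free_lie_algebra_def)
  obtain h where h: "h \<in> lie_hom K ?P B" "\<And>x. x \<in> X \<Longrightarrow> h (lie_cong K X {} `` {Gen x}) = g x"
    using B.lie_presented_lift[OF g, of "{}"] by auto
  let ?i = "inv_into (carrier ?P) \<phi>"
  have "inj_on \<phi> (carrier ?P)" using \<phi> by (simp add: lie_iso_def bij_betw_def)
  then have "?i x = lie_cong K X {} `` {Gen x}" if "x \<in> X" for x
    using inv_into_f_f[of \<phi> "carrier ?P" "lie_cong K X {} `` {Gen x}"] that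
    by (simp add: gens carrier_lie_presented lie_terms.Gen)
  moreover have "h \<circ> ?i \<in> lie_hom K F B"
    by (rule lie_hom_comp[OF lie_iso_inv[OF lie_algebra_presented[OF B.field_axioms] \<phi>] h(1)])
  ultimately show ?thesis using that[of "h \<circ> ?i"] h(2) by simp
qed

text \<open>Both maps are pulled back to the presented algebra, where generators decide. Its use is
  to recognize the first component of the lift to the central extension as \<open>p\<close>.\<close>

lemma free_lie_on_hom_eq:
  assumes F: "free_lie_on K F X" and B: "lie_algebra K B"
    and f: "f \<in> lie_hom K F B" and g: "g \<in> lie_hom K F B"
    and eq: "\<And>x. x \<in> X \<Longrightarrow> f x = g x"
    and x: "x \<in> carrier F"
  shows "f x = g x"
proof -
  interpret B: lie_algebra K B by fact
  let ?P = "lie_presented K X {}"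
  obtain \<phi> where \<phi>: "\<phi> \<in> lie_iso K ?P F"
    and gens: "\<And>x. x \<in> X \<Longrightarrow> \<phi> (lie_cong K X {} `` {Gen x}) = x"
    using F by (auto simp: free_lie_on_def free_lie_algebra_def)
  then have hom: "\<phi> \<in> lie_hom K ?P F" and "\<phi> ` carrier ?P = carrier F"
    by (auto simp: lie_iso_def bij_betw_def)
  then obtain t where t: "t \<in> carrier ?P" "x = \<phi> t" using x by blast
  have "(f \<circ> \<phi>) t = (g \<circ> \<phi>) t"
    by (rule lie_presented_hom_eq[OF B.field_axioms B lie_hom_comp[OF hom f] lie_hom_comp[OF hom g] _ t(1)])
      (simp add: gens eq)
  then show ?thesis by (simp add: t)
qed


section \<open>Central extensions\<close>

text \<open>The extension of \<open>L\<close> by the trivial module \<open>A\<close> with factor set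
  \<open>w\<close>. The bracket ignores the second components, so the copy of \<open>A\<close> is
  central; a bracket that \<open>A\<close> may have of its own does not enter.\<close>

definition cocycle_extension ::
    "('k, 'a, 'n) lie_alg_scheme \<Rightarrow> ('k, 'b, 'p) lie_alg_scheme \<Rightarrow> ('a \<Rightarrow> 'a \<Rightarrow> 'b)
      \<Rightarrow> ('k, 'a \<times> 'b) lie_alg" where
  "cocycle_extension L A w =
    \<lparr>carrier = carrier L \<times> carrier A, mult = undefined, one = undefined,
     zero = (\<zero>\<^bsub>L\<^esub>, \<zero>\<^bsub>A\<^esub>),
     add = (\<lambda>x y. (fst x \<oplus>\<^bsub>L\<^esub> fst y, snd x \<oplus>\<^bsub>A\<^esub> snd y)),
     smult = (\<lambda>c x. (c \<odot>\<^bsub>L\<^esub> fst x, c \<odot>\<^bsub>A\<^esub> snd x)),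
     lie_bracket = (\<lambda>x y. (\<lbrace>fst x, fst y\<rbrace>\<^bsub>L\<^esub>, w (fst x) (fst y)))\<rparr>"

text \<open>In the second component [x, [y, z]] is \<open>w\<close> evaluated at x and [y, z]. Hence
  the Jacobi identity there is exactly \<open>cocycle\<close>, and the alternating law is exactly
  \<open>alternating\<close>.\<close>

lemma lie_algebra_cocycle_extension:
  assumes L: "lie_algebra K L" and A: "module K A"
    and closed: "\<And>x y. x \<in> carrier L \<Longrightarrow> y \<in> carrier L \<Longrightarrow> w x y \<in> carrier A"
    and add_l: "\<And>x y z. x \<in> carrier L \<Longrightarrow> y \<in> carrier L \<Longrightarrow> z \<in> carrier L \<Longrightarrow>
      w (x \<oplus>\<^bsub>L\<^esub> y) z = w x z \<oplus>\<^bsub>A\<^esub> w y z"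
    and add_r: "\<And>x y z. x \<in> carrier L \<Longrightarrow> y \<in> carrier L \<Longrightarrow> z \<in> carrier L \<Longrightarrow>
      w x (y \<oplus>\<^bsub>L\<^esub> z) = w x y \<oplus>\<^bsub>A\<^esub> w x z"
    and smult_l: "\<And>c x y. c \<in> carrier K \<Longrightarrow> x \<in> carrier L \<Longrightarrow> y \<in> carrier L \<Longrightarrow>
      w (c \<odot>\<^bsub>L\<^esub> x) y = c \<odot>\<^bsub>A\<^esub> w x y"
    and smult_r: "\<And>c x y. c \<in> carrier K \<Longrightarrow> x \<in> carrier L \<Longrightarrow> y \<in> carrier L \<Longrightarrow>
      w x (c \<odot>\<^bsub>L\<^esub> y) = c \<odot>\<^bsub>A\<^esub> w x y"
    and alternating: "\<And>x. x \<in> carrier L \<Longrightarrow> w x x = \<zero>\<^bsub>A\<^esub>"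
    and cocycle: "\<And>x y z. x \<in> carrier L \<Longrightarrow> y \<in> carrier L \<Longrightarrow> z \<in> carrier L \<Longrightarrow>
      w x \<lbrace>y, z\<rbrace>\<^bsub>L\<^esub> \<oplus>\<^bsub>A\<^esub> w y \<lbrace>z, x\<rbrace>\<^bsub>L\<^esub> \<oplus>\<^bsub>A\<^esub> w z \<lbrace>x, y\<rbrace>\<^bsub>L\<^esub> = \<zero>\<^bsub>A\<^esub>"
  shows "lie_algebra K (cocycle_extension L A w)"
proof -
  interpret L: lie_algebra K L by fact
  interpret A: module K A by fact
  have neg: "(\<ominus>\<^bsub>K\<^esub> \<one>\<^bsub>K\<^esub>) \<odot>\<^bsub>A\<^esub> a \<oplus>\<^bsub>A\<^esub> a = \<zero>\<^bsub>A\<^esub>" if "a \<in> carrier A" for a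
    using that by (simp add: A.smult_l_minus A.M.l_neg)
  show ?thesis
  proof (rule lie_algebraI)
    fix x y assume "x \<in> carrier (cocycle_extension L A w)" "y \<in> carrier (cocycle_extension L A w)"
    then show "x \<oplus>\<^bsub>cocycle_extension L A w\<^esub> y = y \<oplus>\<^bsub>cocycle_extension L A w\<^esub> x"
      by (auto simp: cocycle_extension_def L.M.a_comm A.M.a_comm)
  next
    fix x y z
    assume "x \<in> carrier (cocycle_extension L A w)" "y \<in> carrier (cocycle_extension L A w)"
      "z \<in> carrier (cocycle_extension L A w)"
    then show "x \<oplus>\<^bsub>cocycle_extension L A w\<^esub> y \<oplus>\<^bsub>cocycle_extension L A w\<^esub> z =
        x \<oplus>\<^bsub>cocycle_extension L A w\<^esub> (y \<oplus>\<^bsub>cocycle_extension L A w\<^esub> z)"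
      by (auto simp: cocycle_extension_def L.M.a_assoc A.M.a_assoc)
  qed (simp_all add: cocycle_extension_def L.field_axioms neg closed add_l add_r smult_l smult_r
      alternating cocycle L.bracket_closed mem_Times_iff
      L.minus_conv_smult L.M.l_neg L.smult_l_distr A.smult_l_distr L.smult_r_distr A.smult_r_distr
      L.smult_assoc1 A.smult_assoc1 L.bracket_l_distr L.bracket_r_distr L.bracket_smult_l
      L.bracket_smult_r L.bracket_alternating L.jacobi)
qed


section \<open>The exterior square\<close>

definition wedge ::
    "('k, 'm) ring_scheme \<Rightarrow> ('k, 'l, 'q) lie_alg_scheme \<Rightarrow> 'l \<Rightarrow> 'l
      \<Rightarrow> ('k, 'l \<times> 'l) lie_term set set" where
  "wedge K L l k = box_square K L +>\<^bsub>tensor_square K L\<^esub> tensor K L l k"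

section \<open>The tensor square and its ideal of squares\<close>

context lie_algebra
begin

lemma lie_algebra_tensor_square: "lie_algebra K (tensor_square K L)"
  unfolding tensor_square_def by (rule lie_algebra_presented[OF field_axioms])

text \<open>Relations (iii) and (iv) are written with the formal \<open>Neg\<close>, a scaling by
  -1; this turns it into the additive inverse of the algebra.\<close>

lemma tensor_class_Neg:
  assumes "t \<in> lie_terms K (carrier L \<times> carrier L)"
  shows "lie_cong K (carrier L \<times> carrier L) (tensor_rels K L) `` {Neg K t} =
    \<ominus>\<^bsub>tensor_square K L\<^esub> (lie_cong K (carrier L \<times> carrier L) (tensor_rels K L) `` {t})"
proof -
  interpret T: lie_algebra K "tensor_square K L" by (rule lie_algebra_tensor_square)
  have "lie_cong K (carrier L \<times> carrier L) (tensor_rels K L) `` {t} \<in> carrier (tensor_square K L)"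
    using assms by (simp add: tensor_square_def carrier_lie_presented)
  from T.minus_conv_smult[OF this] show ?thesis
    using assms by (simp add: Neg_def tensor_square_def lie_presented_ops[OF field_axioms])
qed

lemma tensor_closed:
  "l \<in> carrier L \<Longrightarrow> k \<in> carrier L \<Longrightarrow> tensor K L l k \<in> carrier (tensor_square K L)"
  by (auto simp: tensor_def tensor_square_def carrier_lie_presented intro!: lie_terms.Gen)

lemma tensor_relations:
  assumes "l \<in> carrier L" "k \<in> carrier L"
  shows tensor_smult_l: "c \<in> carrier K \<Longrightarrow>
      tensor K L (c \<odot>\<^bsub>L\<^esub> l) k = c \<odot>\<^bsub>tensor_square K L\<^esub> tensor K L l k"
    and tensor_smult_r: "c \<in> carrier K \<Longrightarrow>
      tensor K L l (c \<odot>\<^bsub>L\<^esub> k) = c \<odot>\<^bsub>tensor_square K L\<^esub> tensor K L l k"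
    and tensor_add_l: "l' \<in> carrier L \<Longrightarrow>
      tensor K L (l \<oplus>\<^bsub>L\<^esub> l') k = tensor K L l k \<oplus>\<^bsub>tensor_square K L\<^esub> tensor K L l' k"
    and tensor_add_r: "k' \<in> carrier L \<Longrightarrow>
      tensor K L l (k \<oplus>\<^bsub>L\<^esub> k') = tensor K L l k \<oplus>\<^bsub>tensor_square K L\<^esub> tensor K L l k'"
    and tensor_bracket_l: "l' \<in> carrier L \<Longrightarrow>
      tensor K L \<lbrace>l, l'\<rbrace>\<^bsub>L\<^esub> k =
        tensor K L l \<lbrace>l', k\<rbrace>\<^bsub>L\<^esub> \<oplus>\<^bsub>tensor_square K L\<^esub> (\<ominus>\<^bsub>tensor_square K L\<^esub> tensor K L l' \<lbrace>l, k\<rbrace>\<^bsub>L\<^esub>)"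
    and tensor_bracket: "l' \<in> carrier L \<Longrightarrow> k' \<in> carrier L \<Longrightarrow>
      \<lbrace>tensor K L l k, tensor K L l' k'\<rbrace>\<^bsub>tensor_square K L\<^esub> =
        \<ominus>\<^bsub>tensor_square K L\<^esub> tensor K L \<lbrace>k, l\<rbrace>\<^bsub>L\<^esub> \<lbrace>l', k'\<rbrace>\<^bsub>L\<^esub>"
proof -
  note [simp] = assms bracket_closed
  let ?X = "carrier L \<times> carrier L" and ?S = "tensor_rels K L"
  note G = lie_terms.Gen[of _ ?X K]
  note T = lie_terms.intros(2-) Neg_in_lie_terms[OF field_axioms]
  have rel: "lie_cong K ?X ?S `` {s} = lie_cong K ?X ?S `` {t}"
    if "(s, t) \<in> ?S" "s \<in> lie_terms K ?X" "t \<in> lie_terms K ?X" for s t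
    using lie_cong.rel[OF that] that by (simp add: lie_cong_class_eq_iff[OF field_axioms])
  note ops = lie_presented_ops[OF field_axioms, where X = ?X and S = ?S, folded tensor_square_def]
    tensor_class_Neg[symmetric]
  show "tensor K L (c \<odot>\<^bsub>L\<^esub> l) k = c \<odot>\<^bsub>tensor_square K L\<^esub> tensor K L l k"
    "tensor K L l (c \<odot>\<^bsub>L\<^esub> k) = c \<odot>\<^bsub>tensor_square K L\<^esub> tensor K L l k" if [simp]: "c \<in> carrier K" for c
    using rel[OF tensor_rels.scale_l[of c K l L k]] rel[OF tensor_rels.scale_r[of c K l L k]]
    by (simp_all add: tensor_def ops G T)
  show "tensor K L (l \<oplus>\<^bsub>L\<^esub> l') k = tensor K L l k \<oplus>\<^bsub>tensor_square K L\<^esub> tensor K L l' k"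
    if [simp]: "l' \<in> carrier L" for l'
    using rel[OF tensor_rels.add_l[of l L l' k K]] by (simp add: tensor_def ops G T)
  show "tensor K L l (k \<oplus>\<^bsub>L\<^esub> k') = tensor K L l k \<oplus>\<^bsub>tensor_square K L\<^esub> tensor K L l k'"
    if [simp]: "k' \<in> carrier L" for k'
    using rel[OF tensor_rels.add_r[of l L k k' K]] by (simp add: tensor_def ops G T)
  show "tensor K L \<lbrace>l, l'\<rbrace>\<^bsub>L\<^esub> k =
        tensor K L l \<lbrace>l', k\<rbrace>\<^bsub>L\<^esub> \<oplus>\<^bsub>tensor_square K L\<^esub> (\<ominus>\<^bsub>tensor_square K L\<^esub> tensor K L l' \<lbrace>l, k\<rbrace>\<^bsub>L\<^esub>)"
    if [simp]: "l' \<in> carrier L" for l'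
    using rel[OF tensor_rels.bracket_l[of l L l' k K]] by (simp add: tensor_def ops G T)
  show "\<lbrace>tensor K L l k, tensor K L l' k'\<rbrace>\<^bsub>tensor_square K L\<^esub> =
        \<ominus>\<^bsub>tensor_square K L\<^esub> tensor K L \<lbrace>k, l\<rbrace>\<^bsub>L\<^esub> \<lbrace>l', k'\<rbrace>\<^bsub>L\<^esub>"
    if [simp]: "l' \<in> carrier L" "k' \<in> carrier L" for l' k'
    using rel[OF tensor_rels.bracket[of l L k l' k' K]] by (simp add: tensor_def ops G T)
qed

lemma tensor_zero_l:
  assumes "k \<in> carrier L"
  shows "tensor K L \<zero>\<^bsub>L\<^esub> k = \<zero>\<^bsub>tensor_square K L\<^esub>"
proof -
  interpret T: lie_algebra K "tensor_square K L" by (rule lie_algebra_tensor_square)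
  show ?thesis
    using tensor_smult_l[of "\<zero>\<^bsub>L\<^esub>" k "\<zero>"] assms tensor_closed[of "\<zero>\<^bsub>L\<^esub>" k] by simp
qed

text \<open>By relation (iv) the linear span of the symbols is closed under brackets.\<close>
lemma tensor_square_span:
  "carrier (tensor_square K L) = (\<lambda>N. submodule N K (tensor_square K L)) hull
     {tensor K L l k | l k. l \<in> carrier L \<and> k \<in> carrier L}" (is "_ = ?H")
proof
  let ?T = "tensor_square K L" and ?X = "carrier L \<times> carrier L" and ?S = "tensor_rels K L"
  let ?A = "{tensor K L l k | l k. l \<in> carrier L \<and> k \<in> carrier L}"
  interpret T: lie_algebra K ?T by (rule lie_algebra_tensor_square)
  have A: "?A \<subseteq> carrier ?T" using tensor_closed by blast
  show "?H \<subseteq> carrier ?T" by (rule T.hull_subset_carrier[OF A])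
  have H: "submodule ?H K ?T" by (rule T.submodule_hull[OF A])
  have zero: "\<zero>\<^bsub>?T\<^esub> \<in> ?H" using H T.submodule_iff by blast
  note closed = T.submoduleE(3-5)[OF H]
  have carr: "x \<in> carrier ?T" if "x \<in> ?H" for x using that T.hull_subset_carrier[OF A] by blast
  have gen: "tensor K L l k \<in> ?H" if "l \<in> carrier L" "k \<in> carrier L" for l k
    using that by (intro hull_inc) blast
  \<comment> \<open>Closure under brackets by linearity in each argument separately: first with a
    symbol on the left, where (iv) applies, then with any element of the span on the left.\<close>
  have br_gen: "\<lbrace>tensor K L l k, y\<rbrace>\<^bsub>?T\<^esub> \<in> ?H"
    if y: "y \<in> ?H" and lk: "l \<in> carrier L" "k \<in> carrier L" for y l k
    using y A
  proof (induction rule: T.submodule_hull_induct)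
    case (generator y)
    then obtain l' k' where "l' \<in> carrier L" "k' \<in> carrier L" "y = tensor K L l' k'" by blast
    with lk show ?case by (simp add: tensor_bracket bracket_closed closed gen)
  qed (simp_all add: T.bracket_zero_r T.bracket_r_distr T.bracket_smult_r tensor_closed lk zero closed)
  have br: "\<lbrace>x, y\<rbrace>\<^bsub>?T\<^esub> \<in> ?H" if x: "x \<in> ?H" and y: "y \<in> ?H" for x y
    using x A
  proof (induction rule: T.submodule_hull_induct)
    case (generator x)
    with br_gen[OF y] show ?case by blast
  qed (simp_all add: T.bracket_zero_l T.bracket_l_distr T.bracket_smult_l zero closed carr[OF y])
  \<comment> \<open>The span contains the generators and is closed under all operations, so
    induction on terms shows that it is everything.\<close>
  have "lie_cong K ?X ?S `` {t} \<in> ?H" if "t \<in> lie_terms K ?X" for t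
    using that
  proof induction
    case (Gen x)
    then show ?case using gen by (auto simp: tensor_def)
  next
    case Null
    then show ?case using zero by (simp add: tensor_square_def lie_presented_def)
  next
    case (Add s t)
    then show ?case using closed(3)[OF Add.IH]
      by (simp add: tensor_square_def lie_presented_ops[OF field_axioms])
  next
    case (Scale c t)
    then show ?case using closed(2)[OF Scale.hyps(1) Scale.IH]
      by (simp add: tensor_square_def lie_presented_ops[OF field_axioms])
  next
    case (Br s t)
    then show ?case using br[OF Br.IH]
      by (simp add: tensor_square_def lie_presented_ops[OF field_axioms])
  qed
  then show "carrier ?T \<subseteq> ?H" by (auto simp: tensor_square_def carrier_lie_presented)
qed

text \<open>The box square is even central: by (iv) the bracket of l \<otimes> l with l' \<otimes>
  k' is -([l, l] \<otimes> [l', k']), which vanishes because [l, l] = 0. Linearity in both arguments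
  extends this from symbols.\<close>

lemma lie_ideal_box_square: "lie_ideal K (tensor_square K L) (box_square K L)"
proof -
  let ?T = "tensor_square K L" and ?B = "{tensor K L l l | l. l \<in> carrier L}"
  let ?A = "{tensor K L l k | l k. l \<in> carrier L \<and> k \<in> carrier L}"
  interpret T: lie_algebra K ?T by (rule lie_algebra_tensor_square)
  have A: "?A \<subseteq> carrier ?T" and B: "?B \<subseteq> carrier ?T" using tensor_closed by blast+
  have gen: "\<lbrace>tensor K L l l, y\<rbrace>\<^bsub>?T\<^esub> = \<zero>\<^bsub>?T\<^esub>"
    if y: "y \<in> carrier ?T" and l: "l \<in> carrier L" for y l
    using y[unfolded tensor_square_span] A
  proof (induction rule: T.submodule_hull_induct)
    case (generator y)
    then obtain l' k' where "l' \<in> carrier L" "k' \<in> carrier L" "y = tensor K L l' k'" by blast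
    with l show ?case
      by (simp add: tensor_bracket bracket_alternating tensor_zero_l bracket_closed)
  qed (simp_all add: T.bracket_zero_r T.bracket_r_distr T.bracket_smult_r tensor_closed l)
  have "\<lbrace>x, y\<rbrace>\<^bsub>?T\<^esub> = \<zero>\<^bsub>?T\<^esub>" if x: "x \<in> box_square K L" and y: "y \<in> carrier ?T" for x y
    using x[unfolded box_square_def] B
  proof (induction rule: T.submodule_hull_induct)
    case (generator x)
    with gen[OF y] show ?case by blast
  qed (simp_all add: T.bracket_zero_l T.bracket_l_distr T.bracket_smult_l y)
  moreover have S: "submodule (box_square K L) K ?T"
    unfolding box_square_def by (rule T.submodule_hull[OF B])
  moreover have "\<zero>\<^bsub>?T\<^esub> \<in> box_square K L" using S T.submodule_iff by blast
  ultimately show ?thesis by (simp add: lie_ideal_def)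
qed

section \<open>The exterior square: relations, induction, universal property\<close>

lemma lie_algebra_exterior_square: "lie_algebra K (exterior_square K L)"
  unfolding exterior_square_def
  by (rule lie_algebra.lie_algebra_quotient[OF lie_algebra_tensor_square lie_ideal_box_square])

lemma exterior_proj_hom:
  "(\<lambda>x. box_square K L +>\<^bsub>tensor_square K L\<^esub> x) \<in> lie_hom K (tensor_square K L) (exterior_square K L)"
  unfolding exterior_square_def
  by (rule lie_algebra.lie_quotient_proj_hom[OF lie_algebra_tensor_square lie_ideal_box_square])

lemma wedge_closed:
  "l \<in> carrier L \<Longrightarrow> k \<in> carrier L \<Longrightarrow> wedge K L l k \<in> carrier (exterior_square K L)"
  unfolding wedge_def by (intro lie_hom_closed[OF exterior_proj_hom] tensor_closed)

lemma wedge_relations: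
  assumes "l \<in> carrier L" "k \<in> carrier L"
  shows wedge_smult_l: "c \<in> carrier K \<Longrightarrow>
      wedge K L (c \<odot>\<^bsub>L\<^esub> l) k = c \<odot>\<^bsub>exterior_square K L\<^esub> wedge K L l k"
    and wedge_smult_r: "c \<in> carrier K \<Longrightarrow>
      wedge K L l (c \<odot>\<^bsub>L\<^esub> k) = c \<odot>\<^bsub>exterior_square K L\<^esub> wedge K L l k"
    and wedge_add_l: "l' \<in> carrier L \<Longrightarrow>
      wedge K L (l \<oplus>\<^bsub>L\<^esub> l') k = wedge K L l k \<oplus>\<^bsub>exterior_square K L\<^esub> wedge K L l' k"
    and wedge_add_r: "k' \<in> carrier L \<Longrightarrow>
      wedge K L l (k \<oplus>\<^bsub>L\<^esub> k') = wedge K L l k \<oplus>\<^bsub>exterior_square K L\<^esub> wedge K L l k'"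
    and wedge_bracket_l: "l' \<in> carrier L \<Longrightarrow>
      wedge K L \<lbrace>l, l'\<rbrace>\<^bsub>L\<^esub> k = wedge K L l \<lbrace>l', k\<rbrace>\<^bsub>L\<^esub>
        \<oplus>\<^bsub>exterior_square K L\<^esub> (\<ominus>\<^bsub>exterior_square K L\<^esub> wedge K L l' \<lbrace>l, k\<rbrace>\<^bsub>L\<^esub>)"
    and wedge_alternating: "wedge K L l l = \<zero>\<^bsub>exterior_square K L\<^esub>"
proof -
  interpret T: lie_algebra K "tensor_square K L" by (rule lie_algebra_tensor_square)
  note h = lie_homD(2-3)[OF exterior_proj_hom]
    lie_hom_minus[OF lie_algebra_tensor_square lie_algebra_exterior_square exterior_proj_hom]
  note [simp] = assms bracket_closed
  show "wedge K L (c \<odot>\<^bsub>L\<^esub> l) k = c \<odot>\<^bsub>exterior_square K L\<^esub> wedge K L l k"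
    "wedge K L l (c \<odot>\<^bsub>L\<^esub> k) = c \<odot>\<^bsub>exterior_square K L\<^esub> wedge K L l k" if [simp]: "c \<in> carrier K" for c
    by (simp_all add: wedge_def tensor_smult_l tensor_smult_r h tensor_closed)
  show "wedge K L (l \<oplus>\<^bsub>L\<^esub> l') k = wedge K L l k \<oplus>\<^bsub>exterior_square K L\<^esub> wedge K L l' k"
    if [simp]: "l' \<in> carrier L" for l'
    by (simp_all add: wedge_def tensor_add_l h tensor_closed)
  show "wedge K L l (k \<oplus>\<^bsub>L\<^esub> k') = wedge K L l k \<oplus>\<^bsub>exterior_square K L\<^esub> wedge K L l k'"
    if [simp]: "k' \<in> carrier L" for k'
    by (simp_all add: wedge_def tensor_add_r h tensor_closed)
  show "wedge K L \<lbrace>l, l'\<rbrace>\<^bsub>L\<^esub> k = wedge K L l \<lbrace>l', k\<rbrace>\<^bsub>L\<^esub>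
        \<oplus>\<^bsub>exterior_square K L\<^esub> (\<ominus>\<^bsub>exterior_square K L\<^esub> wedge K L l' \<lbrace>l, k\<rbrace>\<^bsub>L\<^esub>)"
    if [simp]: "l' \<in> carrier L" for l'
    by (simp_all add: wedge_def tensor_bracket_l h tensor_closed)
  have "tensor K L l l \<in> box_square K L"
    unfolding box_square_def using assms by (intro hull_inc) blast
  moreover have "subgroup (box_square K L) (add_monoid (tensor_square K L))"
    using lie_ideal_box_square by (simp add: lie_ideal_def submodule_def)
  ultimately have "wedge K L l l = box_square K L"
    unfolding wedge_def by (intro T.M.a_coset_join2) (simp_all add: tensor_closed)
  then show "wedge K L l l = \<zero>\<^bsub>exterior_square K L\<^esub>"
    by (simp add: exterior_square_def lie_quotient_def)
qed

text \<open>Polarization again, now of (x + y) \<and> (x + y) = 0.\<close>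

lemma wedge_skew:
  assumes "x \<in> carrier L" "y \<in> carrier L"
  shows "wedge K L y x = \<ominus>\<^bsub>exterior_square K L\<^esub> wedge K L x y"
proof -
  interpret W: lie_algebra K "exterior_square K L" by (rule lie_algebra_exterior_square)
  have "wedge K L (x \<oplus>\<^bsub>L\<^esub> y) (x \<oplus>\<^bsub>L\<^esub> y) = wedge K L y x \<oplus>\<^bsub>exterior_square K L\<^esub> wedge K L x y"
    using assms
    by (subst wedge_add_l)
      (simp_all add: wedge_add_r wedge_closed wedge_alternating W.M.a_comm)
  moreover have "wedge K L (x \<oplus>\<^bsub>L\<^esub> y) (x \<oplus>\<^bsub>L\<^esub> y) = \<zero>\<^bsub>exterior_square K L\<^esub>"
    using assms by (simp add: wedge_alternating)
  ultimately have "wedge K L y x \<oplus>\<^bsub>exterior_square K L\<^esub> wedge K L x y = \<zero>\<^bsub>exterior_square K L\<^esub>"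
    by metis
  then have "\<ominus>\<^bsub>exterior_square K L\<^esub> wedge K L x y = wedge K L y x"
    using assms by (intro W.M.minus_equality wedge_closed)
  then show ?thesis by (rule HOL.sym)
qed

text \<open>Skew-symmetry turns z \<and> [x, y] into -([x, y] \<and> z), and the first half of (iii)
  expands this to -(x \<and> [y, z] + y \<and> [z, x]), which cancels the other two terms.\<close>

lemma wedge_cocycle:
  assumes [simp]: "x \<in> carrier L" "y \<in> carrier L" "z \<in> carrier L"
  shows "wedge K L x \<lbrace>y, z\<rbrace>\<^bsub>L\<^esub> \<oplus>\<^bsub>exterior_square K L\<^esub> wedge K L y \<lbrace>z, x\<rbrace>\<^bsub>L\<^esub>
    \<oplus>\<^bsub>exterior_square K L\<^esub> wedge K L z \<lbrace>x, y\<rbrace>\<^bsub>L\<^esub> = \<zero>\<^bsub>exterior_square K L\<^esub>"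
proof -
  interpret W: lie_algebra K "exterior_square K L" by (rule lie_algebra_exterior_square)
  note [simp] = bracket_closed wedge_closed
  have "wedge K L y \<lbrace>z, x\<rbrace>\<^bsub>L\<^esub> = wedge K L y ((\<ominus> \<one>) \<odot>\<^bsub>L\<^esub> \<lbrace>x, z\<rbrace>\<^bsub>L\<^esub>)"
    using bracket_skew[of x z] by (simp add: minus_conv_smult)
  then have 1: "wedge K L y \<lbrace>z, x\<rbrace>\<^bsub>L\<^esub> = \<ominus>\<^bsub>exterior_square K L\<^esub> wedge K L y \<lbrace>x, z\<rbrace>\<^bsub>L\<^esub>"
    by (simp add: wedge_smult_r W.minus_conv_smult)
  have "wedge K L z \<lbrace>x, y\<rbrace>\<^bsub>L\<^esub> = \<ominus>\<^bsub>exterior_square K L\<^esub> wedge K L \<lbrace>x, y\<rbrace>\<^bsub>L\<^esub> z"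
    by (rule wedge_skew) simp_all
  also have "\<dots> = \<ominus>\<^bsub>exterior_square K L\<^esub> (wedge K L x \<lbrace>y, z\<rbrace>\<^bsub>L\<^esub>
      \<oplus>\<^bsub>exterior_square K L\<^esub> wedge K L y \<lbrace>z, x\<rbrace>\<^bsub>L\<^esub>)"
    by (simp add: wedge_bracket_l 1)
  finally show ?thesis by (simp add: W.M.r_neg)
qed

text \<open>The symbols span the tensor square linearly, hence their images span the quotient; no
  induction step for brackets is required.\<close>

lemma exterior_square_induct [consumes 1, case_names wedge zero add smult]:
  assumes u: "u \<in> carrier (exterior_square K L)"
    and gen: "\<And>l k. l \<in> carrier L \<Longrightarrow> k \<in> carrier L \<Longrightarrow> P (wedge K L l k)"
    and zero: "P \<zero>\<^bsub>exterior_square K L\<^esub>"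
    and add: "\<And>u v. u \<in> carrier (exterior_square K L) \<Longrightarrow> v \<in> carrier (exterior_square K L) \<Longrightarrow>
      P u \<Longrightarrow> P v \<Longrightarrow> P (u \<oplus>\<^bsub>exterior_square K L\<^esub> v)"
    and smult: "\<And>c u. c \<in> carrier K \<Longrightarrow> u \<in> carrier (exterior_square K L) \<Longrightarrow>
      P u \<Longrightarrow> P (c \<odot>\<^bsub>exterior_square K L\<^esub> u)"
  shows "P u"
proof -
  let ?T = "tensor_square K L" and ?W = "exterior_square K L"
  let ?A = "{tensor K L l k | l k. l \<in> carrier L \<and> k \<in> carrier L}"
  let ?q = "\<lambda>t. box_square K L +>\<^bsub>?T\<^esub> t"
  interpret T: lie_algebra K ?T by (rule lie_algebra_tensor_square)
  note q = lie_homD[OF exterior_proj_hom]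
    lie_hom_zero[OF lie_algebra_tensor_square lie_algebra_exterior_square exterior_proj_hom]
  obtain t where t: "t \<in> carrier ?T" "u = ?q t"
    using u T.carrier_lie_quotient by (auto simp: exterior_square_def)
  have A: "?A \<subseteq> carrier ?T" using tensor_closed by blast
  have "P (?q t)"
    using t(1)[unfolded tensor_square_span] A
  proof (induction rule: T.submodule_hull_induct)
    case (generator t)
    then show ?case using gen by (auto simp: wedge_def)
  qed (simp_all add: q zero add smult)
  then show ?thesis by (simp add: t)
qed

text \<open>Universal property of L \<and> L: the assumptions on \<open>w\<close> are relations (i)
  to (iv) and vanishing on the diagonal. The former give a map from the tensor square, the latter
  makes it kill the box square.\<close>

lemma exterior_square_lift:
  assumes B: "lie_algebra K B"
    and closed: "\<And>l k. l \<in> carrier L \<Longrightarrow> k \<in> carrier L \<Longrightarrow> w l k \<in> carrier B"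
    and w_smult_l: "\<And>c l k. c \<in> carrier K \<Longrightarrow> l \<in> carrier L \<Longrightarrow> k \<in> carrier L \<Longrightarrow>
      w (c \<odot>\<^bsub>L\<^esub> l) k = c \<odot>\<^bsub>B\<^esub> w l k"
    and w_smult_r: "\<And>c l k. c \<in> carrier K \<Longrightarrow> l \<in> carrier L \<Longrightarrow> k \<in> carrier L \<Longrightarrow>
      w l (c \<odot>\<^bsub>L\<^esub> k) = c \<odot>\<^bsub>B\<^esub> w l k"
    and w_add_l: "\<And>l l' k. l \<in> carrier L \<Longrightarrow> l' \<in> carrier L \<Longrightarrow> k \<in> carrier L \<Longrightarrow>
      w (l \<oplus>\<^bsub>L\<^esub> l') k = w l k \<oplus>\<^bsub>B\<^esub> w l' k"
    and w_add_r: "\<And>l k k'. l \<in> carrier L \<Longrightarrow> k \<in> carrier L \<Longrightarrow> k' \<in> carrier L \<Longrightarrow>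
      w l (k \<oplus>\<^bsub>L\<^esub> k') = w l k \<oplus>\<^bsub>B\<^esub> w l k'"
    and w_bracket_l: "\<And>l l' k. l \<in> carrier L \<Longrightarrow> l' \<in> carrier L \<Longrightarrow> k \<in> carrier L \<Longrightarrow>
      w \<lbrace>l, l'\<rbrace>\<^bsub>L\<^esub> k = w l \<lbrace>l', k\<rbrace>\<^bsub>L\<^esub> \<oplus>\<^bsub>B\<^esub> (\<ominus>\<^bsub>B\<^esub> w l' \<lbrace>l, k\<rbrace>\<^bsub>L\<^esub>)"
    and w_bracket_r: "\<And>l k k'. l \<in> carrier L \<Longrightarrow> k \<in> carrier L \<Longrightarrow> k' \<in> carrier L \<Longrightarrow>
      w l \<lbrace>k, k'\<rbrace>\<^bsub>L\<^esub> = w \<lbrace>k', l\<rbrace>\<^bsub>L\<^esub> k \<oplus>\<^bsub>B\<^esub> (\<ominus>\<^bsub>B\<^esub> w \<lbrace>k, l\<rbrace>\<^bsub>L\<^esub> k')"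
    and w_bracket: "\<And>l k l' k'. l \<in> carrier L \<Longrightarrow> k \<in> carrier L \<Longrightarrow> l' \<in> carrier L \<Longrightarrow> k' \<in> carrier L \<Longrightarrow>
      \<lbrace>w l k, w l' k'\<rbrace>\<^bsub>B\<^esub> = \<ominus>\<^bsub>B\<^esub> w \<lbrace>k, l\<rbrace>\<^bsub>L\<^esub> \<lbrace>l', k'\<rbrace>\<^bsub>L\<^esub>"
    and alternating: "\<And>l. l \<in> carrier L \<Longrightarrow> w l l = \<zero>\<^bsub>B\<^esub>"
  obtains h where "h \<in> lie_hom K (exterior_square K L) B"
    and "\<And>l k. l \<in> carrier L \<Longrightarrow> k \<in> carrier L \<Longrightarrow> h (wedge K L l k) = w l k"
proof -
  let ?T = "tensor_square K L" and ?X = "carrier L \<times> carrier L" and ?S = "tensor_rels K L"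
  interpret T: lie_algebra K ?T by (rule lie_algebra_tensor_square)
  interpret B: lie_algebra K B by fact
  let ?g = "\<lambda>(l, k). w l k"
  have g: "?g \<in> ?X \<rightarrow> carrier B" using closed by auto
  have "lie_eval B ?g s = lie_eval B ?g t" if "(s, t) \<in> ?S" for s t
    using that
  proof cases
    case (bracket_l l l' k)
    then show ?thesis
      by (simp add: w_bracket_l[of l l' k] B.lie_eval_Neg[OF g] lie_terms.Gen bracket_closed)
  next
    case (bracket_r l k k')
    then show ?thesis
      by (simp add: w_bracket_r[of l k k'] B.lie_eval_Neg[OF g] lie_terms.Gen bracket_closed)
  next
    case (bracket l k l' k')
    then show ?thesis
      by (simp add: w_bracket[of l k l' k'] B.lie_eval_Neg[OF g] lie_terms.Gen bracket_closed)
  qed (simp_all add: w_smult_l w_smult_r w_add_l w_add_r)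
  then obtain h where h: "h \<in> lie_hom K ?T B"
    and h_gen: "\<And>x. x \<in> ?X \<Longrightarrow> h (lie_cong K ?X ?S `` {Gen x}) = ?g x"
    using B.lie_presented_lift[OF g, of ?S] unfolding tensor_square_def by blast
  have h_tensor: "h (tensor K L l k) = w l k" if "l \<in> carrier L" "k \<in> carrier L" for l k
    using h_gen[of "(l, k)"] that by (simp add: tensor_def)
  have B_sub: "{tensor K L l l | l. l \<in> carrier L} \<subseteq> carrier ?T" using tensor_closed by blast
  have kernel: "h x = \<zero>\<^bsub>B\<^esub>" if "x \<in> box_square K L" for x
    using that[unfolded box_square_def] B_sub
  proof (induction rule: T.submodule_hull_induct)
    case (generator x)
    then show ?case by (auto simp: h_tensor alternating)
  next
    case zero
    show ?case by (rule lie_hom_zero[OF lie_algebra_tensor_square B h])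
  qed (simp_all add: lie_homD[OF h])
  obtain h' where "h' \<in> lie_hom K (exterior_square K L) B"
    "\<And>x. x \<in> carrier ?T \<Longrightarrow> h' (box_square K L +>\<^bsub>?T\<^esub> x) = h x"
    using T.lie_quotient_lift[OF lie_ideal_box_square B h kernel] unfolding exterior_square_def by blast
  then show ?thesis using that[of h'] by (simp add: wedge_def tensor_closed h_tensor)
qed

end


section \<open>Free presentations\<close>

text \<open>The Jacobi identity in the shape of the second half of relation (iii), obtained from the
  first by skew-symmetry.\<close>

lemma (in lie_algebra) bracket_derivation_r:
  assumes [simp]: "x \<in> carrier L" "y \<in> carrier L" "z \<in> carrier L"
  shows "\<lbrace>x, \<lbrace>y, z\<rbrace>\<^bsub>L\<^esub>\<rbrace>\<^bsub>L\<^esub> = \<lbrace>\<lbrace>z, x\<rbrace>\<^bsub>L\<^esub>, y\<rbrace>\<^bsub>L\<^esub> \<oplus>\<^bsub>L\<^esub> (\<ominus>\<^bsub>L\<^esub> \<lbrace>\<lbrace>y, x\<rbrace>\<^bsub>L\<^esub>, z\<rbrace>\<^bsub>L\<^esub>)"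
proof -
  note [simp] = bracket_closed
  have "\<lbrace>x, \<lbrace>y, z\<rbrace>\<^bsub>L\<^esub>\<rbrace>\<^bsub>L\<^esub> = \<ominus>\<^bsub>L\<^esub> \<lbrace>\<lbrace>y, z\<rbrace>\<^bsub>L\<^esub>, x\<rbrace>\<^bsub>L\<^esub>"
    by (rule bracket_skew) simp_all
  also have "\<dots> = (\<ominus>\<^bsub>L\<^esub> \<lbrace>y, \<lbrace>z, x\<rbrace>\<^bsub>L\<^esub>\<rbrace>\<^bsub>L\<^esub>) \<oplus>\<^bsub>L\<^esub> \<lbrace>z, \<lbrace>y, x\<rbrace>\<^bsub>L\<^esub>\<rbrace>\<^bsub>L\<^esub>"
    by (simp add: bracket_derivation[of y z x] M.minus_add)
  also have "\<ominus>\<^bsub>L\<^esub> \<lbrace>y, \<lbrace>z, x\<rbrace>\<^bsub>L\<^esub>\<rbrace>\<^bsub>L\<^esub> = \<lbrace>\<lbrace>z, x\<rbrace>\<^bsub>L\<^esub>, y\<rbrace>\<^bsub>L\<^esub>"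
    by (rule bracket_skew[symmetric]) simp_all
  also have "\<lbrace>z, \<lbrace>y, x\<rbrace>\<^bsub>L\<^esub>\<rbrace>\<^bsub>L\<^esub> = \<ominus>\<^bsub>L\<^esub> \<lbrace>\<lbrace>y, x\<rbrace>\<^bsub>L\<^esub>, z\<rbrace>\<^bsub>L\<^esub>"
    by (rule bracket_skew) simp_all
  finally show ?thesis .
qed

text \<open>\<open>D\<close> is the second component of a lift of \<open>p\<close> to the central
  extension by the wedge cocycle. Its value on a bracket depends only on the images under
  \<open>p\<close>, because the bracket of the extension sees first components only.\<close>

lemma wedge_lift:
  assumes L: "lie_algebra K L" and free: "free_lie_on K F X" and F: "lie_algebra K F"
    and p: "p \<in> lie_hom K F L"
  obtains D where "\<And>x. x \<in> carrier F \<Longrightarrow> D x \<in> carrier (exterior_square K L)"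
    and "\<And>x y. x \<in> carrier F \<Longrightarrow> y \<in> carrier F \<Longrightarrow> D (x \<oplus>\<^bsub>F\<^esub> y) = D x \<oplus>\<^bsub>exterior_square K L\<^esub> D y"
    and "\<And>c x. c \<in> carrier K \<Longrightarrow> x \<in> carrier F \<Longrightarrow> D (c \<odot>\<^bsub>F\<^esub> x) = c \<odot>\<^bsub>exterior_square K L\<^esub> D x"
    and "\<And>x y. x \<in> carrier F \<Longrightarrow> y \<in> carrier F \<Longrightarrow> D \<lbrace>x, y\<rbrace>\<^bsub>F\<^esub> = wedge K L (p x) (p y)"
proof -
  interpret L: lie_algebra K L by fact
  interpret F: lie_algebra K F by fact
  let ?W = "exterior_square K L"
  interpret W: lie_algebra K ?W by (rule L.lie_algebra_exterior_square)
  let ?E = "cocycle_extension L ?W (wedge K L)"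
  have E: "lie_algebra K ?E"
    by (rule lie_algebra_cocycle_extension[OF L W.module_axioms])
      (simp_all add: L.wedge_closed L.wedge_relations L.wedge_cocycle)
  have X: "X \<subseteq> carrier F" using free by (simp add: free_lie_on_def)
  then have "(\<lambda>x. (p x, \<zero>\<^bsub>?W\<^esub>)) \<in> X \<rightarrow> carrier ?E"
    using lie_hom_closed[OF p] by (auto simp: cocycle_extension_def)
  \<comment> \<open>The zero in the second component is an arbitrary choice: linearity and the
    formula for brackets determine \<open>D\<close> on F^2 whatever is put there.\<close>
  then obtain \<phi> where \<phi>: "\<phi> \<in> lie_hom K F ?E" and gen: "\<And>x. x \<in> X \<Longrightarrow> \<phi> x = (p x, \<zero>\<^bsub>?W\<^esub>)"
    by (rule free_lie_on_lift[OF free E]) blast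
  have "fst \<in> lie_hom K ?E L"
    by (rule lie_homI) (auto simp: cocycle_extension_def)
  then have "fst \<circ> \<phi> \<in> lie_hom K F L" by (rule lie_hom_comp[OF \<phi>])
  \<comment> \<open>Two homomorphisms on F that agree on the free generators are equal; so the lift
    really lies over \<open>p\<close>, also off the generators.\<close>
  then have fst: "fst (\<phi> x) = p x" if "x \<in> carrier F" for x
    using free_lie_on_hom_eq[OF free L _ p _ that, of "fst \<circ> \<phi>"] gen by simp
  note h = lie_homD[OF \<phi>]
  show ?thesis
    by (rule that[of "\<lambda>x. snd (\<phi> x)"])
      (use h(1) in \<open>simp_all add: h(2-4) fst[symmetric] cocycle_extension_def mem_Times_iff\<close>)
qed

section \<open>A fixed free presentation and the quotient F^2/[R, F]\<close>

locale free_lie_presentation =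
  fixes K :: "('k, 'm) ring_scheme"
    and L :: "('k, 'l, 'q) lie_alg_scheme"
    and F :: "('k, 'f, 'n) lie_alg_scheme"
    and R :: "'f set"
    and p :: "'f \<Rightarrow> 'l"
  assumes lie_algebra_L: "lie_algebra K L"
    and presentation: "free_presentation K R F L p"
begin

sublocale L: lie_algebra K L by (rule lie_algebra_L)

sublocale F: lie_algebra K F
  using presentation by (simp add: free_presentation_def is_free_lie_def)

definition F2 where "F2 = lie_commutator K F (carrier F) (carrier F)"
definition N where "N = lie_commutator K F R (carrier F)"

lemma p_hom: "p \<in> lie_hom K F L" and R_ideal: "lie_ideal K F R" and p_surj: "p ` carrier F = carrier L"
  using presentation unfolding free_presentation_def by blast+

lemma R_eq: "R = {x \<in> carrier F. p x = \<zero>\<^bsub>L\<^esub>}"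
  using presentation by (auto simp: free_presentation_def a_kernel_def')

lemma bracket_sets:
  "{\<lbrace>a, b\<rbrace>\<^bsub>F\<^esub> | a b. a \<in> carrier F \<and> b \<in> carrier F} \<subseteq> carrier F"
  "{\<lbrace>a, b\<rbrace>\<^bsub>F\<^esub> | a b. a \<in> R \<and> b \<in> carrier F} \<subseteq> carrier F"
  using F.bracket_closed by (auto simp: R_eq)

lemma submodule_F2: "submodule F2 K F" and submodule_N: "submodule N K F"
  unfolding F2_def N_def lie_commutator_def by (intro F.submodule_hull bracket_sets)+

lemma F2_subset: "x \<in> F2 \<Longrightarrow> x \<in> carrier F"
  using F.submoduleE(1)[OF submodule_F2] by blast

lemma bracket_in_F2: "x \<in> carrier F \<Longrightarrow> y \<in> carrier F \<Longrightarrow> \<lbrace>x, y\<rbrace>\<^bsub>F\<^esub> \<in> F2"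
  unfolding F2_def lie_commutator_def by (intro hull_inc) blast

lemma bracket_in_N: "x \<in> R \<Longrightarrow> y \<in> carrier F \<Longrightarrow> \<lbrace>x, y\<rbrace>\<^bsub>F\<^esub> \<in> N"
  unfolding N_def lie_commutator_def by (intro hull_inc) blast

lemma N_subset_F2: "N \<subseteq> F2"
  unfolding N_def F2_def lie_commutator_def by (rule hull_mono) (auto simp: R_eq)

lemma N_subset_R: "N \<subseteq> R"
  unfolding N_def lie_commutator_def
  by (rule hull_minimal) (use R_ideal in \<open>auto simp: lie_ideal_def\<close>)

abbreviation "G \<equiv> derived_subalgebra K F"

lemma G_simps [simp]:
  "carrier G = F2" "add G = add F" "zero G = zero F" "smult G = smult F" "lie_bracket G = lie_bracket F"
  by (simp_all add: derived_subalgebra_def F2_def)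

sublocale G: lie_algebra K G
  using F.lie_algebra_restrict[OF submodule_F2] bracket_in_F2 F2_subset
  by (simp add: derived_subalgebra_def F2_def)

text \<open>The additive inverse is not a record field but is described relative to the carrier, so
  \<open>G_simps\<close> does not transfer it; as a multiple by -1 it does transfer.\<close>

lemma minus_G: "x \<in> F2 \<Longrightarrow> \<ominus>\<^bsub>G\<^esub> x = \<ominus>\<^bsub>F\<^esub> x"
  using G.minus_conv_smult[of x] F.minus_conv_smult[of x] F2_subset by simp

text \<open>[R, F] lies in the ideal R, so bracketing it with elements of F^2 gives brackets of the
  form [r, f] again. The ideal is taken in F^2, the algebra that is divided.\<close>

lemma N_ideal: "lie_ideal K G N"
proof -
  have "submodule N K G"
    using submodule_N N_subset_F2 unfolding F.submodule_iff G.submodule_iff by simp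
  then show ?thesis
    using N_subset_R bracket_in_N F2_subset by (auto simp: lie_ideal_def)
qed

definition Q where "Q = lie_quotient G N"
definition q where "q x = N +>\<^bsub>G\<^esub> x"

sublocale Q: lie_algebra K Q
  unfolding Q_def by (rule G.lie_algebra_quotient[OF N_ideal])

lemma q_hom: "q \<in> lie_hom K G Q"
  unfolding Q_def q_def[abs_def] by (rule G.lie_quotient_proj_hom[OF N_ideal])

lemma q_ops:
  assumes "x \<in> F2"
  shows "q x \<in> carrier Q"
    and "y \<in> F2 \<Longrightarrow> q (x \<oplus>\<^bsub>F\<^esub> y) = q x \<oplus>\<^bsub>Q\<^esub> q y"
    and "c \<in> carrier K \<Longrightarrow> q (c \<odot>\<^bsub>F\<^esub> x) = c \<odot>\<^bsub>Q\<^esub> q x"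
    and "y \<in> F2 \<Longrightarrow> q \<lbrace>x, y\<rbrace>\<^bsub>F\<^esub> = \<lbrace>q x, q y\<rbrace>\<^bsub>Q\<^esub>"
    and "q (\<ominus>\<^bsub>F\<^esub> x) = \<ominus>\<^bsub>Q\<^esub> q x"
  using lie_homD[OF q_hom] lie_hom_minus[OF G.lie_algebra_axioms Q.lie_algebra_axioms q_hom, of x] assms
  by (simp_all add: minus_G)

lemma q_zero: "q \<zero>\<^bsub>F\<^esub> = \<zero>\<^bsub>Q\<^esub>"
  using lie_hom_zero[OF G.lie_algebra_axioms Q.lie_algebra_axioms q_hom] by simp

lemma q_eq_iff: "x \<in> F2 \<Longrightarrow> y \<in> F2 \<Longrightarrow> q x = q y \<longleftrightarrow> x \<oplus>\<^bsub>F\<^esub> (\<ominus>\<^bsub>F\<^esub> y) \<in> N"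
  using G.coset_eq_iff[of N x y] N_ideal by (simp add: q_def minus_G lie_ideal_def)

lemma diff_in_R:
  assumes "x \<in> carrier F" "y \<in> carrier F" "p x = p y"
  shows "x \<oplus>\<^bsub>F\<^esub> (\<ominus>\<^bsub>F\<^esub> y) \<in> R"
  using assms lie_hom_closed[OF p_hom, of y]
  by (simp add: R_eq lie_hom_add[OF p_hom] L.M.r_neg
      lie_hom_minus[OF F.lie_algebra_axioms L.lie_algebra_axioms p_hom])

text \<open>If \<open>p u = p u'\<close>, then u - u' lies in R and [u, v] - [u', v] = [u - u', v]
  lies in [R, F]. So modulo [R, F] a bracket depends only on the images in L.\<close>

lemma q_bracket_cong:
  assumes [simp]: "x \<in> carrier F" "x' \<in> carrier F" "y \<in> carrier F" "y' \<in> carrier F"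
    and "p x = p x'" "p y = p y'"
  shows "q \<lbrace>x, y\<rbrace>\<^bsub>F\<^esub> = q \<lbrace>x', y'\<rbrace>\<^bsub>F\<^esub>"
proof -
  have l: "q \<lbrace>u, v\<rbrace>\<^bsub>F\<^esub> = q \<lbrace>u', v\<rbrace>\<^bsub>F\<^esub>"
    if [simp]: "u \<in> carrier F" "u' \<in> carrier F" "v \<in> carrier F" and "p u = p u'" for u u' v
    using bracket_in_N[OF diff_in_R[of u u'] , of v] that
    by (simp add: q_eq_iff bracket_in_F2 F.bracket_l_distr F.bracket_minus_l)
  have "q \<lbrace>x, y\<rbrace>\<^bsub>F\<^esub> = q \<lbrace>x', y\<rbrace>\<^bsub>F\<^esub>" by (rule l) (use assms in auto)
  \<comment> \<open>The auxiliary fact \<open>l\<close> changes a left argument; skew-symmetry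
    brings the right argument there and back.\<close>
  also have "\<dots> = \<ominus>\<^bsub>Q\<^esub> q \<lbrace>y, x'\<rbrace>\<^bsub>F\<^esub>"
    using F.bracket_skew[of y x'] by (simp add: q_ops bracket_in_F2)
  also have "q \<lbrace>y, x'\<rbrace>\<^bsub>F\<^esub> = q \<lbrace>y', x'\<rbrace>\<^bsub>F\<^esub>" by (rule l) (use assms in auto)
  also have "\<ominus>\<^bsub>Q\<^esub> \<dots> = q \<lbrace>x', y'\<rbrace>\<^bsub>F\<^esub>"
    using F.bracket_skew[of y' x'] by (simp add: q_ops bracket_in_F2)
  finally show ?thesis .
qed

lemma exterior_square_to_Q:
  obtains h where "h \<in> lie_hom K (exterior_square K L) Q"
    and "\<And>x y. x \<in> carrier F \<Longrightarrow> y \<in> carrier F \<Longrightarrow> h (wedge K L (p x) (p y)) = q \<lbrace>x, y\<rbrace>\<^bsub>F\<^esub>"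
proof -
  let ?s = "inv_into (carrier F) p"
  \<comment> \<open>The section \<open>?s\<close> is merely a set-theoretic choice and need not be
    linear. By \<open>q_bracket_cong\<close> all preimages give the same value, so each relation can
    be verified on preimages that are combined in F.\<close>
  define w where "w l k = q \<lbrace>?s l, ?s k\<rbrace>\<^bsub>F\<^esub>" for l k
  have w: "w (p x) (p y) = q \<lbrace>x, y\<rbrace>\<^bsub>F\<^esub>" if "x \<in> carrier F" "y \<in> carrier F" for x y
    unfolding w_def by (rule q_bracket_cong) (use that in \<open>auto simp: f_inv_into_f inv_into_into\<close>)
  have repr: "\<exists>x. x \<in> carrier F \<and> l = p x" if "l \<in> carrier L" for l
    using that p_surj by blast
  note [simp] = F.bracket_closed bracket_in_F2
  note ops = lie_homD(2-4)[OF p_hom, symmetric] w q_ops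
  obtain h where h: "h \<in> lie_hom K (exterior_square K L) Q"
    "\<And>l k. l \<in> carrier L \<Longrightarrow> k \<in> carrier L \<Longrightarrow> h (wedge K L l k) = w l k"
  proof (rule L.exterior_square_lift[OF Q.lie_algebra_axioms, of w])
    fix l k assume "l \<in> carrier L" "k \<in> carrier L"
    then obtain x y where [simp]: "x \<in> carrier F" "y \<in> carrier F" and eq: "l = p x" "k = p y"
      using repr by metis
    show "w l k \<in> carrier Q" unfolding eq by (simp add: ops)
    show "w l l = \<zero>\<^bsub>Q\<^esub>" unfolding eq by (simp add: w F.bracket_alternating q_zero)
    show "w (c \<odot>\<^bsub>L\<^esub> l) k = c \<odot>\<^bsub>Q\<^esub> w l k" "w l (c \<odot>\<^bsub>L\<^esub> k) = c \<odot>\<^bsub>Q\<^esub> w l k" if "c \<in> carrier K" for c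
      unfolding eq using that by (simp_all add: ops F.bracket_smult_l F.bracket_smult_r)
    fix m assume "m \<in> carrier L"
    then obtain z where [simp]: "z \<in> carrier F" and eqm: "m = p z" using repr by metis
    show "w (l \<oplus>\<^bsub>L\<^esub> k) m = w l m \<oplus>\<^bsub>Q\<^esub> w k m" "w l (k \<oplus>\<^bsub>L\<^esub> m) = w l k \<oplus>\<^bsub>Q\<^esub> w l m"
      unfolding eq eqm by (simp_all add: ops F.bracket_l_distr F.bracket_r_distr)
    \<comment> \<open>Both halves of (iii) are forms of the Jacobi identity of F, pushed through
      \<open>q\<close>.\<close>
    show "w \<lbrace>l, k\<rbrace>\<^bsub>L\<^esub> m = w l \<lbrace>k, m\<rbrace>\<^bsub>L\<^esub> \<oplus>\<^bsub>Q\<^esub> (\<ominus>\<^bsub>Q\<^esub> w k \<lbrace>l, m\<rbrace>\<^bsub>L\<^esub>)"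
      unfolding eq eqm using arg_cong[OF F.bracket_derivation[of x y z], of q]
      by (simp add: lie_homD(4)[OF p_hom, symmetric] w q_ops(2,5) F.submoduleE(3)[OF submodule_F2])
    show "w l \<lbrace>k, m\<rbrace>\<^bsub>L\<^esub> = w \<lbrace>m, l\<rbrace>\<^bsub>L\<^esub> k \<oplus>\<^bsub>Q\<^esub> (\<ominus>\<^bsub>Q\<^esub> w \<lbrace>k, l\<rbrace>\<^bsub>L\<^esub> m)"
      unfolding eq eqm using arg_cong[OF F.bracket_derivation_r[of x y z], of q]
      by (simp add: lie_homD(4)[OF p_hom, symmetric] w q_ops(2,5) F.submoduleE(3)[OF submodule_F2])
    fix n assume "n \<in> carrier L"
    then obtain u where [simp]: "u \<in> carrier F" and eqn: "n = p u" using repr by metis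
    \<comment> \<open>The sign in (iv) comes from its reversed first bracket [k, l].\<close>
    have "\<lbrace>\<lbrace>x, y\<rbrace>\<^bsub>F\<^esub>, \<lbrace>z, u\<rbrace>\<^bsub>F\<^esub>\<rbrace>\<^bsub>F\<^esub> = \<ominus>\<^bsub>F\<^esub> \<lbrace>\<lbrace>y, x\<rbrace>\<^bsub>F\<^esub>, \<lbrace>z, u\<rbrace>\<^bsub>F\<^esub>\<rbrace>\<^bsub>F\<^esub>"
      using F.bracket_skew[of x y] by (simp add: F.bracket_minus_l)
    from arg_cong[OF this, of q]
    show "\<lbrace>w l k, w m n\<rbrace>\<^bsub>Q\<^esub> = \<ominus>\<^bsub>Q\<^esub> w \<lbrace>k, l\<rbrace>\<^bsub>L\<^esub> \<lbrace>m, n\<rbrace>\<^bsub>L\<^esub>"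
      unfolding eq eqm eqn
      by (simp add: lie_homD(4)[OF p_hom, symmetric] w q_ops(5) q_ops(4)[symmetric])
  qed blast
  show ?thesis
    by (rule that[OF h(1)]) (simp add: h(2) w lie_hom_closed[OF p_hom])
qed

text \<open>\<open>D\<close> maps F^2 onto L \<and> L, is constant on the fibres of \<open>q\<close>
  there, and satisfies h D = q. Bijectivity of the homomorphism \<open>h\<close> follows, so no
  homomorphism property of the inverse has to be checked.\<close>

lemma exterior_square_isomorphic: "lie_isomorphic K (exterior_square K L) Q"
proof -
  let ?W = "exterior_square K L"
  interpret W: lie_algebra K ?W by (rule L.lie_algebra_exterior_square)
  obtain h where h: "h \<in> lie_hom K ?W Q"
    and h_wedge: "\<And>x y. x \<in> carrier F \<Longrightarrow> y \<in> carrier F \<Longrightarrow> h (wedge K L (p x) (p y)) = q \<lbrace>x, y\<rbrace>\<^bsub>F\<^esub>"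
    using exterior_square_to_Q by blast
  obtain X where X: "free_lie_on K F X"
    using presentation by (auto simp: free_presentation_def is_free_lie_def)
  obtain D where D_closed: "\<And>x. x \<in> carrier F \<Longrightarrow> D x \<in> carrier ?W"
    and D_add: "\<And>x y. x \<in> carrier F \<Longrightarrow> y \<in> carrier F \<Longrightarrow> D (x \<oplus>\<^bsub>F\<^esub> y) = D x \<oplus>\<^bsub>?W\<^esub> D y"
    and D_smult: "\<And>c x. c \<in> carrier K \<Longrightarrow> x \<in> carrier F \<Longrightarrow> D (c \<odot>\<^bsub>F\<^esub> x) = c \<odot>\<^bsub>?W\<^esub> D x"
    and D_bracket: "\<And>x y. x \<in> carrier F \<Longrightarrow> y \<in> carrier F \<Longrightarrow> D \<lbrace>x, y\<rbrace>\<^bsub>F\<^esub> = wedge K L (p x) (p y)"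
    using wedge_lift[OF lie_algebra_L X F.lie_algebra_axioms p_hom] by blast
  have D_zero: "D \<zero>\<^bsub>F\<^esub> = \<zero>\<^bsub>?W\<^esub>"
    using D_smult[of "\<zero>\<^bsub>K\<^esub>" "\<zero>\<^bsub>F\<^esub>"] D_closed[of "\<zero>\<^bsub>F\<^esub>"] by simp
  have D_minus: "D (\<ominus>\<^bsub>F\<^esub> x) = \<ominus>\<^bsub>?W\<^esub> D x" if "x \<in> carrier F" for x
    using D_smult[of "\<ominus>\<^bsub>K\<^esub> \<one>\<^bsub>K\<^esub>" x] that D_closed[of x]
    by (simp add: F.minus_conv_smult W.minus_conv_smult)
  \<comment> \<open>On a generator [a, b] with a in R the value is \<open>p a\<close> \<and>
    \<open>p b\<close> with \<open>p a\<close> zero.\<close>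
  have D_N: "D x = \<zero>\<^bsub>?W\<^esub>" if "x \<in> N" for x
    using that[unfolded N_def lie_commutator_def] bracket_sets(2)
  proof (induction rule: F.submodule_hull_induct)
    case (generator x)
    then obtain a b where ab: "a \<in> R" "b \<in> carrier F" "x = \<lbrace>a, b\<rbrace>\<^bsub>F\<^esub>" by blast
    then have "D x = wedge K L \<zero>\<^bsub>L\<^esub> (p b)" by (simp add: D_bracket R_eq)
    also have "\<dots> = \<zero>\<^bsub>?W\<^esub>"
      using L.wedge_smult_l[of "\<zero>\<^bsub>L\<^esub>" "p b" "\<zero>\<^bsub>K\<^esub>"] lie_hom_closed[OF p_hom ab(2)]
        L.wedge_closed[of "\<zero>\<^bsub>L\<^esub>" "p b"] by simp
    finally show ?case .
  qed (simp_all add: D_zero D_add D_smult)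
  have D_cong: "D x = D y" if xy: "x \<in> F2" "y \<in> F2" "q x = q y" for x y
  proof -
    have [simp]: "x \<in> carrier F" "y \<in> carrier F" using xy F2_subset by auto
    have "D (x \<oplus>\<^bsub>F\<^esub> (\<ominus>\<^bsub>F\<^esub> y)) = \<zero>\<^bsub>?W\<^esub>" using xy by (intro D_N) (simp add: q_eq_iff)
    then have "D x \<oplus>\<^bsub>?W\<^esub> (\<ominus>\<^bsub>?W\<^esub> D y) = \<zero>\<^bsub>?W\<^esub>" by (simp add: D_add D_minus)
    then show ?thesis
      using D_closed[of x] D_closed[of y]
      by (metis W.M.minus_equality W.M.minus_minus W.M.a_inv_closed \<open>x \<in> carrier F\<close> \<open>y \<in> carrier F\<close>)
  qed
  have h_D: "h (D x) = q x" if "x \<in> F2" for x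
  proof -
    \<comment> \<open>Membership in \<open>F2\<close> is carried along because the induction rule
      only supplies membership in the carrier of F, while the rules for \<open>q\<close> hold on
      \<open>F2\<close>.\<close>
    have "x \<in> F2 \<and> h (D x) = q x"
      using that[unfolded F2_def lie_commutator_def] bracket_sets(1)
    proof (induction rule: F.submodule_hull_induct)
      case (generator x)
      then show ?case by (auto simp: D_bracket h_wedge bracket_in_F2)
    next
      case zero
      show ?case
        using lie_hom_zero[OF W.lie_algebra_axioms Q.lie_algebra_axioms h] submodule_F2
        unfolding F.submodule_iff by (simp add: D_zero q_zero)
    qed (auto simp: D_add D_smult D_closed lie_homD[OF h] q_ops F.submoduleE(4,5)[OF submodule_F2])
    then show ?thesis by simp
  qed
  \<comment> \<open>The symbols span L \<and> L, and each of them is the value of \<open>D\<close>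
    at a bracket of preimages.\<close>
  have D_surj: "\<exists>x\<in>F2. u = D x" if "u \<in> carrier ?W" for u
    using that
  proof (induction rule: L.exterior_square_induct)
    case (wedge l k)
    then obtain x y where "x \<in> carrier F" "y \<in> carrier F" "l = p x" "k = p y"
      using p_surj by (metis imageE)
    then show ?case using D_bracket bracket_in_F2 by metis
  next
    case zero
    then show ?case using D_zero submodule_F2 unfolding F.submodule_iff by metis
  next
    case (add u v)
    then show ?case using D_add F.submoduleE(5)[OF submodule_F2] F2_subset by metis
  next
    case (smult c u)
    then show ?case using D_smult F.submoduleE(4)[OF submodule_F2] F2_subset by metis
  qed
  \<comment> \<open>Writing u = D x and v = D y with x and y in F^2, equality of \<open>h u\<close>
    and \<open>h v\<close> means \<open>q x = q y\<close>, hence D x = D y.\<close>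
  have "inj_on h (carrier ?W)"
  proof (rule inj_onI)
    fix u v assume "u \<in> carrier ?W" "v \<in> carrier ?W" "h u = h v"
    then show "u = v" using D_surj D_cong h_D by metis
  qed
  moreover have "carrier Q \<subseteq> h ` carrier ?W"
  proof
    fix y assume "y \<in> carrier Q"
    then obtain x where x: "x \<in> F2" "y = q x"
      by (auto simp: Q_def G.carrier_lie_quotient q_def)
    then show "y \<in> h ` carrier ?W"
      using h_D[OF x(1)] D_closed F2_subset by (metis imageI)
  qed
  moreover have "h ` carrier ?W \<subseteq> carrier Q" using lie_hom_closed[OF h] by blast
  ultimately have "h \<in> lie_iso K ?W Q" using h by (auto simp: lie_iso_def bij_betw_def)
  then show ?thesis by (auto simp: lie_isomorphic_def)
qed

end

theorem theorem2p10:
  fixes K :: "('k, 'm) ring_scheme"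
    and L :: "('k, 'l, 'q) lie_alg_scheme"
    and F :: "('k, 'f, 'n) lie_alg_scheme"
    and R :: "'f set"
    and p :: "'f \<Rightarrow> 'l"
  assumes "field K"
    and "lie_algebra K L"
    and "free_presentation K R F L p"
  shows "lie_isomorphic K (exterior_square K L)
    (lie_quotient (derived_subalgebra K F) (lie_commutator K F R (carrier F)))"
proof -
  interpret free_lie_presentation K L F R p
    by (rule free_lie_presentation.intro[OF assms(2,3)])
  show ?thesis using exterior_square_isomorphic by (simp add: Q_def N_def)
qed

end
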